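(* Let $n$ be a positive integer, $\mathbf{a}=(a_1,\ldots,a_n)\in\mathbb{Z}^n$ with $a_i\ge1$ for all $i$, and let $T$ be a multitree of type $\mathbf{a}$. Then \[ h^\ast(\mathcal{C}_T;z)=\prod_{i=1}^n\bigl((1+z)^{a_i}+2a_iz(1+z)^{a_i-1}\bigr). \]
   Context: A multi-edge of a graph is the multiset of all edges between two given distinct vertices; its multiplicity is its cardinality. A multitree of type $\mathbf{a}$ is a connected (loopless) graph on vertex set $[n+1]$ whose edge set consists of $n$ multi-edges $F_1,\ldots,F_n$, where $F_i$ has multiplicity $a_i$. For a graph $G=(V,E)$, with $\mathbf{e}_\alpha$ the standard unit vectors of $\mathbb{R}^{V\cup E}$, the cosmological polytope is $\mathcal{C}_G=\mathrm{conv}(\mathbf{e}_i+\mathbf{e}_j-\mathbf{e}_f,\ \mathbf{e}_i-\mathbf{e}_j+\mathbf{e}_f,\ -\mathbf{e}_i+\mathbf{e}_j+\mathbf{e}_f : f\in E\text{ with endpoints }i,j)$, of dimension $|V|+|E|-1$. For a $d$-dimensional lattice polytope $P\subset\mathbb{R}^N$, $h^\ast(P;z)$ is defined by $1+\sum_{t\ge1}|tP\cap\mathbb{Z}^N|z^t=h^\ast(P;z)/(1-z)^{d+1}$. *)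

theory Defs
  imports "HOL-Analysis.Analysis" "HOL-Computational_Algebra.Computational_Algebra"
begin

text \<open>
  A finite graph, possibly with parallel edges, has the finite type \<open>'v\<close> as its vertex set, the
  finite type \<open>'e\<close> as its edge set, and is given by the map sending an edge to its set of
  endpoints. The space \<open>\<real>\<^bsup>V \<union> E\<^esup>\<close> (disjoint union) is then \<open>real ^ ('v + 'e)\<close>.
\<close>

definition loopless :: "('e \<Rightarrow> 'v set) \<Rightarrow> bool" where
  "loopless ends \<longleftrightarrow> (\<forall>f. card (ends f) = 2)"

definition adjacent :: "('e \<Rightarrow> 'v set) \<Rightarrow> 'v \<Rightarrow> 'v \<Rightarrow> bool" where
  "adjacent ends u v \<longleftrightarrow> (\<exists>f. ends f = {u, v})"

definition connected_graph :: "('e \<Rightarrow> 'v set) \<Rightarrow> bool" where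
  "connected_graph ends \<longleftrightarrow> (\<forall>u v. (adjacent ends)\<^sup>*\<^sup>* u v)"

definition edges_between :: "('e \<Rightarrow> 'v set) \<Rightarrow> 'v \<Rightarrow> 'v \<Rightarrow> 'e set" where
  "edges_between ends u v = {f. ends f = {u, v}}"

text \<open>
  Edges are labelled, so a multi-edge is an honest set of edges. Pairs of non-adjacent vertices
  do not contribute a multi-edge.
\<close>

definition multi_edges :: "('e \<Rightarrow> 'v set) \<Rightarrow> 'e set set" where
  "multi_edges ends = {edges_between ends u v | u v. u \<noteq> v \<and> edges_between ends u v \<noteq> {}}"

text \<open>The type \<open>a = (a\<^sub>1, \<dots>, a\<^sub>n)\<close> is a function of which only the values on \<open>{1..n}\<close> matter.\<close>

definition multitree :: "nat \<Rightarrow> (nat \<Rightarrow> nat) \<Rightarrow> ('e::finite \<Rightarrow> 'v::finite set) \<Rightarrow> bool" where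
  "multitree n a ends \<longleftrightarrow>
     loopless ends \<and> connected_graph ends \<and> CARD('v) = n + 1 \<and>
     (\<exists>F. bij_betw F {1..n} (multi_edges ends) \<and> (\<forall>i\<in>{1..n}. card (F i) = a i))"

definition vertex_vec :: "'v \<Rightarrow> real ^ ('v::finite + 'e::finite)" where
  "vertex_vec i = axis (Inl i) 1"

definition edge_vec :: "'e \<Rightarrow> real ^ ('v::finite + 'e::finite)" where
  "edge_vec f = axis (Inr f) 1"

definition cosmological_polytope ::
    "('e::finite \<Rightarrow> 'v::finite set) \<Rightarrow> (real ^ ('v + 'e)) set" where
  "cosmological_polytope ends = convex hull
     (\<Union>{ { vertex_vec i + vertex_vec j - edge_vec f,
            vertex_vec i - vertex_vec j + edge_vec f,
            - vertex_vec i + vertex_vec j + edge_vec f } | f i j. ends f = {i, j} })"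

definition lattice_points :: "(real ^ 'n) set \<Rightarrow> (real ^ 'n) set" where
  "lattice_points P = {x \<in> P. \<forall>k. x $ k \<in> \<int>}"

definition ehrhart_series :: "(real ^ 'n) set \<Rightarrow> int fps" where
  "ehrhart_series P = Abs_fps (\<lambda>t. if t = 0 then 1
     else int (card (lattice_points ((\<lambda>x. real t *\<^sub>R x) ` P))))"

text \<open>
  The defining identity \<open>Ehr(z) = h(z) / (1 - z)\<^bsup>d+1\<^esup>\<close> with \<open>d = dim P\<close>, solved for \<open>h\<close>
  in the ring of formal power series, where \<open>1 - z\<close> is a unit.
\<close>

definition h_star :: "(real ^ 'n) set \<Rightarrow> int fps" where
  "h_star P = ehrhart_series P * (1 - fps_X) ^ nat (aff_dim P + 1)"

end

theory Submission
  imports Defs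
begin

text \<open>
  A lattice point of a dilate of the polytope splits into one contribution for each edge \<open>f\<close> with
  endpoints \<open>i, j\<close>, namely a point of the cone given by \<open>x\<^sub>i + x\<^sub>j \<ge> 0\<close>, \<open>x\<^sub>i + x\<^sub>f \<ge> 0\<close>,
  \<open>x\<^sub>j + x\<^sub>f \<ge> 0\<close>. For a multi-edge with edge coordinates \<open>y\<close>, the sum of these cones depends
  only on the sums \<open>P\<close> and \<open>N\<close> of the positive and negative parts of \<open>y\<close>: after subtracting
  \<open>N\<close> from both endpoints it is the region \<open>z\<^sub>i, z\<^sub>j \<ge> -P\<close>, \<open>z\<^sub>i + z\<^sub>j \<ge> 0\<close>. On a tree,
  feasibility is decided by removing a leaf \<open>v\<close> attached to \<open>u\<close>: it amounts to \<open>z\<^sub>v \<ge> -P\<close>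
  together with feasibility on the smaller tree after replacing \<open>z\<^sub>u\<close> by \<open>z\<^sub>u + min P z\<^sub>v\<close>. This
  is a bijection of integer points, so the Ehrhart series is a product over multi-edges. A
  multi-edge of multiplicity \<open>b\<close> contributes
  \<open>\<Sum> q\<^bsup>|y|\<^esup> (2 P(y) + 1 / (1 - q))\<close> over all integer vectors \<open>y\<close> of length \<open>b\<close>, which is
  \<open>((1 + q)\<^bsup>b\<^esup> + 2 b q (1 + q)\<^bsup>b-1\<^esup>) / (1 - q)\<^bsup>b+1\<^esup>\<close>.
\<close>

no_notation fps_nth (infixl "$" 75)

subsection \<open>Weighted generating functions\<close>

text \<open>The series of \<open>m x * q ^ w x\<close> summed over \<open>X\<close>. Finiteness of
  the fibres is part of the notion because a sum over an infinite set is 0 by convention. Weights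
  are integers since coordinates may be negative, and \<open>0 \<le> w x\<close> keeps points from
  escaping the count.\<close>

definition has_gf :: "'x set \<Rightarrow> ('x \<Rightarrow> int) \<Rightarrow> ('x \<Rightarrow> int) \<Rightarrow> int fps \<Rightarrow> bool" where
  "has_gf X w m F \<longleftrightarrow> (\<forall>x\<in>X. 0 \<le> w x) \<and>
     (\<forall>t::nat. finite {x\<in>X. w x = int t} \<and> (\<Sum>x\<in>{x\<in>X. w x = int t}. m x) = fps_nth F t)"

lemma has_gf_cong:
  assumes "has_gf X w m F" "\<And>x. x \<in> X \<Longrightarrow> w x = w' x" "\<And>x. x \<in> X \<Longrightarrow> m x = m' x"
  shows "has_gf X w' m' F"
proof -
  have "{x\<in>X. w' x = int t} = {x\<in>X. w x = int t}" for t
    using assms(2) by auto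
  moreover have "(\<Sum>x\<in>{x\<in>X. w x = int t}. m' x) = (\<Sum>x\<in>{x\<in>X. w x = int t}. m x)" for t
    using assms(3) by (intro sum.cong) auto
  ultimately show ?thesis
    using assms(1,2) by (simp add: has_gf_def)
qed

lemma has_gf_bij:
  assumes G: "has_gf Y w' m' F" and h: "bij_betw h X Y"
    and "\<And>x. x \<in> X \<Longrightarrow> w' (h x) = w x" "\<And>x. x \<in> X \<Longrightarrow> m' (h x) = m x"
  shows "has_gf X w m F"
proof -
  have "has_gf X (w' \<circ> h) (m' \<circ> h) F"
    unfolding has_gf_def
  proof (intro conjI allI ballI)
    show "0 \<le> (w' \<circ> h) x" if "x \<in> X" for x
      using that G h by (auto simp: has_gf_def bij_betw_def)
  next
    fix t
    have b: "bij_betw h {x\<in>X. (w' \<circ> h) x = int t} {y\<in>Y. w' y = int t}"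
      using h by (force simp: bij_betw_def inj_on_def)
    show "finite {x\<in>X. (w' \<circ> h) x = int t}"
      using bij_betw_finite[OF b] G by (simp add: has_gf_def)
    show "(\<Sum>x\<in>{x\<in>X. (w' \<circ> h) x = int t}. (m' \<circ> h) x) = fps_nth F t"
      using sum.reindex_bij_betw[OF b, of m'] G by (simp add: has_gf_def)
  qed
  then show ?thesis
    by (rule has_gf_cong) (use assms in auto)
qed

lemma has_gf_add:
  assumes "has_gf X w m F" "has_gf X w m' G"
  shows "has_gf X w (\<lambda>x. m x + m' x) (F + G)"
  using assms by (simp add: has_gf_def sum.distrib)

lemma has_gf_Un:
  assumes "has_gf X w m F" "has_gf Y w m G" "X \<inter> Y = {}"
  shows "has_gf (X \<union> Y) w m (F + G)"
  unfolding has_gf_def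
proof (intro conjI allI ballI)
  fix t
  have eq: "{x \<in> X \<union> Y. w x = int t} = {x\<in>X. w x = int t} \<union> {x\<in>Y. w x = int t}"
    by auto
  show "finite {x \<in> X \<union> Y. w x = int t}"
    using assms(1,2) unfolding eq has_gf_def by simp
  have "(\<Sum>x\<in>{x \<in> X \<union> Y. w x = int t}. m x) =
      (\<Sum>x\<in>{x\<in>X. w x = int t}. m x) + (\<Sum>x\<in>{x\<in>Y. w x = int t}. m x)"
    unfolding eq by (rule sum.union_disjoint) (use assms in \<open>auto simp: has_gf_def\<close>)
  then show "(\<Sum>x\<in>{x \<in> X \<union> Y. w x = int t}. m x) = fps_nth (F + G) t"
    using assms(1,2) by (simp add: has_gf_def)
qed (use assms in \<open>auto simp: has_gf_def\<close>)

text \<open>Cauchy product: as both weights are nonnegative, the fibre of total weight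
  \<open>t\<close> is the disjoint union over \<open>i \<le> t\<close> of a fibre of weight
  \<open>i\<close> times one of weight \<open>t - i\<close>.\<close>

lemma has_gf_times:
  assumes X: "has_gf X w m F" and Y: "has_gf Y w' m' G"
  shows "has_gf (X \<times> Y) (\<lambda>p. w (fst p) + w' (snd p)) (\<lambda>p. m (fst p) * m' (snd p)) (F * G)"
  unfolding has_gf_def
proof (intro conjI allI ballI)
  show "0 \<le> w (fst p) + w' (snd p)" if "p \<in> X \<times> Y" for p
    using that X Y by (auto simp: has_gf_def)
next
  fix t
  let ?A = "\<lambda>i. {x\<in>X. w x = int i}" and ?B = "\<lambda>i. {y\<in>Y. w' y = int i}"
  let ?S = "{p \<in> X \<times> Y. w (fst p) + w' (snd p) = int t}"
  have eq: "?S = (\<Union>i\<in>{0..t}. ?A i \<times> ?B (t - i))"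
  proof (intro equalityI subsetI)
    fix p assume p: "p \<in> ?S"
    then have "0 \<le> w (fst p)" "0 \<le> w' (snd p)"
      using X Y by (auto simp: has_gf_def)
    then have "nat (w (fst p)) \<in> {0..t}" "p \<in> ?A (nat (w (fst p))) \<times> ?B (t - nat (w (fst p)))"
      using p by auto
    then show "p \<in> (\<Union>i\<in>{0..t}. ?A i \<times> ?B (t - i))"
      by blast
  qed auto
  have fin: "finite (?A i)" "finite (?B i)" for i
    using X Y by (auto simp: has_gf_def)
  show "finite ?S"
    unfolding eq using fin by blast
  have "(\<Sum>p\<in>?S. m (fst p) * m' (snd p)) =
      (\<Sum>i=0..t. \<Sum>p\<in>?A i \<times> ?B (t - i). m (fst p) * m' (snd p))"
    unfolding eq by (rule sum.UNION_disjoint) (simp, intro ballI finite_cartesian_product fin, auto)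
  also have "\<dots> = (\<Sum>i=0..t. (\<Sum>x\<in>?A i. m x) * (\<Sum>y\<in>?B (t - i). m' y))"
    by (intro sum.cong refl) (simp add: sum_product sum.cartesian_product case_prod_unfold)
  also have "\<dots> = (\<Sum>i=0..t. fps_nth F i * fps_nth G (t - i))"
  proof -
    have "(\<Sum>x\<in>?A i. m x) = fps_nth F i" "(\<Sum>y\<in>?B i. m' y) = fps_nth G i" for i
      using X Y by (simp_all add: has_gf_def)
    then show ?thesis
      by (simp only:)
  qed
  finally show "(\<Sum>p\<in>?S. m (fst p) * m' (snd p)) = fps_nth (F * G) t"
    by (simp add: fps_mult_nth)
qed

text \<open>Turns a multiplicity into honest points, by stacking \<open>m x\<close> points of equal
  weight over each \<open>x\<close>.\<close>

lemma has_gf_Sigma: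
  assumes X: "has_gf X w m F"
    and A: "\<And>x. x \<in> X \<Longrightarrow> finite (A x) \<and> int (card (A x)) = m x"
  shows "has_gf (Sigma X A) (\<lambda>p. w (fst p)) (\<lambda>_. 1) F"
  unfolding has_gf_def
proof (intro conjI allI ballI)
  fix t
  let ?X = "{x\<in>X. w x = int t}"
  have eq: "{p \<in> Sigma X A. w (fst p) = int t} = Sigma ?X A"
    by auto
  have fin: "finite ?X"
    using X by (simp add: has_gf_def)
  show "finite {p \<in> Sigma X A. w (fst p) = int t}"
    unfolding eq using fin A by auto
  have "(\<Sum>p\<in>Sigma ?X A. (1::int)) = (\<Sum>x\<in>?X. m x)"
    using fin A by simp
  then show "(\<Sum>p\<in>{p \<in> Sigma X A. w (fst p) = int t}. 1) = fps_nth F t"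
    unfolding eq using X by (simp add: has_gf_def)
qed (use X in \<open>auto simp: has_gf_def\<close>)

section \<open>Generating functions of integer vectors\<close>

definition gf_ray :: "int fps" where
  "gf_ray = Abs_fps (\<lambda>_. 1)"

definition gf_line :: "int fps" where
  "gf_line = Abs_fps (\<lambda>t. if t = 0 then 1 else 2)"

text \<open>The expansion of 2q / (1 - q)^2, while \<open>gf_ray\<close> is 1 / (1 - q) and
  \<open>gf_line\<close> is (1 + q) / (1 - q).\<close>

definition gf_pos :: "int fps" where
  "gf_pos = Abs_fps (\<lambda>t. 2 * int t)"

lemma gf_ray_eq: "gf_ray * (1 - fps_X) = 1"
  by (rule fps_ext) (auto simp: gf_ray_def algebra_simps)

lemma gf_line_eq: "gf_line * (1 - fps_X) = 1 + fps_X"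
  by (rule fps_ext) (auto simp: gf_line_def algebra_simps)

lemma gf_pos_eq: "gf_pos * (1 - fps_X) ^ 2 = 2 * fps_X"
proof -
  have 1: "gf_pos * (1 - fps_X) = fps_X * (2 * gf_ray)"
    by (rule fps_ext) (auto simp: gf_pos_def gf_ray_def algebra_simps numeral_fps_const)
  have "gf_pos * (1 - fps_X) ^ 2 = (gf_pos * (1 - fps_X)) * (1 - fps_X)"
    by (simp add: power2_eq_square mult.assoc)
  also have "\<dots> = fps_X * 2 * (gf_ray * (1 - fps_X))"
    by (simp only: 1 mult.assoc)
  finally show ?thesis
    by (simp add: gf_ray_eq)
qed

lemma has_gf_ray: "has_gf {0..} (\<lambda>c. c) (\<lambda>_. 1) gf_ray"
proof -
  have "{x\<in>{0..}. x = int t} = {int t}" for t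
    by auto
  then show ?thesis
    by (simp add: has_gf_def gf_ray_def)
qed

lemma abs_fibre: "{x. \<bar>x\<bar> = int t} = {int t, - int t}"
  by auto

lemma has_gf_line: "has_gf UNIV abs (\<lambda>_. 1) gf_line"
  by (simp add: has_gf_def gf_line_def abs_fibre card_insert_if)

lemma has_gf_pos: "has_gf UNIV abs (\<lambda>y. 2 * max 0 y) gf_pos"
proof -
  have "(\<Sum>x\<in>{int t, - int t}. 2 * max 0 x) = 2 * int t" for t
    by (cases "t = 0") auto
  then show ?thesis
    by (auto simp: has_gf_def gf_pos_def abs_fibre)
qed

text \<open>Integer vectors indexed by \<open>B\<close> are total functions extended by 0, so that
  vectors on disjoint index sets can be glued by addition.\<close>

definition supported :: "'e set \<Rightarrow> ('e \<Rightarrow> int) set" where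
  "supported B = {y. \<forall>e. e \<notin> B \<longrightarrow> y e = 0}"

lemma bij_betw_supported_insert:
  assumes "e \<notin> B"
  shows "bij_betw (\<lambda>y. (y e, y(e := 0))) (supported (insert e B)) (UNIV \<times> supported B)"
  by (rule bij_betw_byWitness[where f' = "\<lambda>p. (snd p)(e := fst p)"])
    (use assms in \<open>auto simp: supported_def fun_eq_iff\<close>)

lemma sum_supported_insert:
  fixes B :: "'e set" and g :: "int \<Rightarrow> int"
  assumes "finite B" "e \<notin> B"
  shows "(\<Sum>x\<in>insert e B. g (y x)) = g (y e) + (\<Sum>x\<in>B. g ((y(e := 0)) x))"
proof -
  have "(\<Sum>x\<in>B. g ((y(e := 0)) x)) = (\<Sum>x\<in>B. g (y x))"
    by (intro sum.cong) (use assms in auto)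
  then show ?thesis
    using assms by simp
qed

lemma has_gf_supported:
  assumes "finite B"
  shows "has_gf (supported B) (\<lambda>y. \<Sum>e\<in>B. \<bar>y e\<bar>) (\<lambda>_. 1) (gf_line ^ card B)"
  using assms
proof (induction B)
  case empty
  have "supported {} = {\<lambda>_::'a. 0::int}"
    by (auto simp: supported_def)
  then show ?case
    by (auto simp: has_gf_def)
next
  case (insert e B)
  have "has_gf (supported (insert e B)) (\<lambda>y. \<Sum>e\<in>insert e B. \<bar>y e\<bar>) (\<lambda>_. 1)
      (gf_line * gf_line ^ card B)"
    by (rule has_gf_bij[OF has_gf_times[OF has_gf_line insert.IH]
          bij_betw_supported_insert[OF insert.hyps(2)]])
      (simp_all add: sum_supported_insert[OF insert.hyps, of abs] del: fun_upd_apply)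
  then show ?case
    using insert.hyps by simp
qed

text \<open>Leibniz rule: the multiplicity is a sum over coordinates, so one coordinate contributes
  \<open>gf_pos\<close> and every other one \<open>gf_line\<close>. The induction separates the
  summand carried by the new coordinate \<open>e\<close>.\<close>

lemma has_gf_supported_pos:
  assumes "finite B"
  shows "has_gf (supported B) (\<lambda>y. \<Sum>e\<in>B. \<bar>y e\<bar>) (\<lambda>y. \<Sum>e\<in>B. 2 * max 0 (y e))
    (of_nat (card B) * gf_pos * gf_line ^ (card B - 1))"
  using assms
proof (induction B)
  case empty
  show ?case
    using has_gf_supported[of "{} :: 'a set"] by (simp add: has_gf_def)
next
  case (insert e B)
  let ?F = "gf_line * (of_nat (card B) * gf_pos * gf_line ^ (card B - 1)) + gf_pos * gf_line ^ card B"
  have "?F = of_nat (card (insert e B)) * gf_pos * gf_line ^ (card (insert e B) - 1)"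
  \<comment> \<open>The exponent \<open>card B - 1\<close> is truncated at 0, where the factor
    \<open>of_nat (card B)\<close> vanishes.\<close>
  proof (cases "card B")
    case 0
    then show ?thesis
      using insert.hyps by simp
  next
    case (Suc c)
    then show ?thesis
      using insert.hyps by (simp add: algebra_simps)
  qed
  moreover have "has_gf (supported (insert e B)) (\<lambda>y. \<Sum>e\<in>insert e B. \<bar>y e\<bar>)
      (\<lambda>y. \<Sum>e\<in>insert e B. 2 * max 0 (y e)) ?F"
    by (rule has_gf_bij[OF has_gf_add[OF has_gf_times[OF has_gf_line insert.IH]
            has_gf_times[OF has_gf_pos has_gf_supported[OF insert.hyps(1)]]]
          bij_betw_supported_insert[OF insert.hyps(2)]])
      (simp_all add: sum_supported_insert[OF insert.hyps, of abs]
        sum_supported_insert[OF insert.hyps, of "\<lambda>t. 2 * max 0 t"] del: fun_upd_apply)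
  ultimately show ?case
    by simp
qed

section \<open>The contribution of one multi-edge\<close>

text \<open>The data removed together with a leaf: the coordinates \<open>y\<close> of its
  multi-edge and the coordinate \<open>c\<close> of the leaf vertex.\<close>

definition leaves :: "'e set \<Rightarrow> (('e \<Rightarrow> int) \<times> int) set" where
  "leaves B = {(y, c). y \<in> supported B \<and> - (\<Sum>e\<in>B. max 0 (y e)) \<le> c}"

text \<open>Of the leaf coordinate \<open>c\<close>, the amount \<open>min P c\<close> is passed on
  to the neighbour; only the remainder counts here.\<close>

definition leaf_weight :: "'e set \<Rightarrow> ('e \<Rightarrow> int) \<times> int \<Rightarrow> int" where
  "leaf_weight B = (\<lambda>(y, c). (\<Sum>e\<in>B. \<bar>y e\<bar>) + (c - min (\<Sum>e\<in>B. max 0 (y e)) c))"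

text \<open>Cut at \<open>c = P\<close>. From \<open>P\<close> upwards the shifted \<open>c\<close>
  runs over a ray. Below \<open>P\<close> the weight does not depend on \<open>c\<close>, which has
  \<open>2 * P\<close> possible values, the multiplicity of
  \<open>has_gf_supported_pos\<close>.\<close>

lemma has_gf_leaves:
  assumes "finite B"
  shows "has_gf (leaves B) (leaf_weight B) (\<lambda>_. 1)
    (gf_line ^ card B * gf_ray + of_nat (card B) * gf_pos * gf_line ^ (card B - 1))"
proof -
  let ?P = "\<lambda>y. \<Sum>e\<in>B. max 0 (y e) :: int"
  let ?hi = "{(y, c). y \<in> supported B \<and> ?P y \<le> c}"
  let ?lo = "Sigma (supported B) (\<lambda>y. {- ?P y..<?P y})"
  have P: "0 \<le> ?P y" for y
    by (intro sum_nonneg) auto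
  have b: "bij_betw (\<lambda>(y, c). (y, c - ?P y)) ?hi (supported B \<times> {0..})"
    by (rule bij_betw_byWitness[where f' = "\<lambda>(y, c). (y, c + ?P y)"]) auto
  have hi: "has_gf ?hi (leaf_weight B) (\<lambda>_. 1) (gf_line ^ card B * gf_ray)"
    by (rule has_gf_bij[OF has_gf_times[OF has_gf_supported[OF assms] has_gf_ray] b])
      (auto simp: leaf_weight_def)
  have "has_gf ?lo (\<lambda>p. \<Sum>e\<in>B. \<bar>fst p e\<bar>) (\<lambda>_. 1)
      (of_nat (card B) * gf_pos * gf_line ^ (card B - 1))"
    by (rule has_gf_Sigma[OF has_gf_supported_pos[OF assms]])
      (use P in \<open>auto simp: sum_distrib_left[symmetric]\<close>)
  then have lo: "has_gf ?lo (leaf_weight B) (\<lambda>_. 1)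
      (of_nat (card B) * gf_pos * gf_line ^ (card B - 1))"
    by (rule has_gf_cong) (auto simp: leaf_weight_def)
  have un: "leaves B = ?hi \<union> ?lo"
  proof -
    have "- ?P y \<le> c" if "?P y \<le> c" for y c
      using P[of y] that by linarith
    then show ?thesis
      by (auto simp: leaves_def)
  qed
  show ?thesis
    unfolding un by (rule has_gf_Un[OF hi lo]) auto
qed

definition edge_factor :: "nat \<Rightarrow> int fps" where
  "edge_factor b = (1 + fps_X) ^ b + of_nat (2 * b) * fps_X * (1 + fps_X) ^ (b - 1)"

text \<open>Each \<open>gf_line\<close> and each \<open>gf_ray\<close> absorbs one factor
  \<open>1 - fps_X\<close>, and \<open>gf_pos\<close> absorbs two; for \<open>b \<ge> 1\<close> both
  summands use up exactly \<open>b + 1\<close> of them.\<close>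

lemma leaves_gf_eq:
  assumes "b \<ge> 1"
  shows "(gf_line ^ b * gf_ray + of_nat b * gf_pos * gf_line ^ (b - 1)) * (1 - fps_X) ^ Suc b = edge_factor b"
proof -
  obtain c where c: "b = Suc c"
    using assms by (cases b) auto
  let ?q = "1 - fps_X :: int fps"
  have "(gf_line ^ b * gf_ray + of_nat b * gf_pos * gf_line ^ (b - 1)) * ?q ^ Suc b
      = (gf_line * ?q) ^ b * (gf_ray * ?q) + of_nat b * (gf_pos * ?q ^ 2) * (gf_line * ?q) ^ c"
    unfolding power_mult_distrib by (simp add: c power2_eq_square) algebra
  also have "\<dots> = edge_factor b"
    by (simp add: gf_line_eq gf_ray_eq gf_pos_eq edge_factor_def c)
  finally show ?thesis .
qed

subsection \<open>Leaf removal\<close>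

text \<open>Edges are endpoint sets, so parallel edges share one element of \<open>K\<close>. Rule
  induction is leaf removal.\<close>

inductive grown_tree :: "'v set \<Rightarrow> 'v set set \<Rightarrow> bool" where
  single: "grown_tree {v} {}"
| grow: "grown_tree S K \<Longrightarrow> u \<in> S \<Longrightarrow> v \<notin> S \<Longrightarrow> grown_tree (insert v S) (insert {u, v} K)"

lemma grown_tree_facts:
  assumes "grown_tree S K"
  shows "finite S" "finite K" "S \<noteq> {}" "card S = Suc (card K)" "\<And>k. k \<in> K \<Longrightarrow> k \<subseteq> S"
  using assms
proof (induction)
  case (grow S K u v)
  {
    case 4
    have "{u, v} \<notin> K"
      using grow by blast
    then show ?case
      using grow by simp
  next
    case 5
    then show ?case
      using grow by auto
  }
qed auto

text \<open>
  The possible vertex coordinates \<open>z\<close> once the edge coordinates are fixed: \<open>w k v\<close> is the part of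
  \<open>z v\<close> contributed by \<open>k\<close>, and \<open>P k\<close> is the sum of the positive parts of the coordinates of the
  edges parallel to \<open>k\<close>.
\<close>

definition splittable :: "'v set \<Rightarrow> 'v set set \<Rightarrow> ('v set \<Rightarrow> real) \<Rightarrow> ('v \<Rightarrow> real) \<Rightarrow> bool" where
  "splittable S K P z \<longleftrightarrow> (\<exists>w. (\<forall>k\<in>K. (\<forall>v\<in>k. - P k \<le> w k v) \<and> 0 \<le> sum (w k) k) \<and>
     (\<forall>v\<in>S. (\<Sum>k | k \<in> K \<and> v \<in> k. w k v) \<le> z v))"

lemma splittable_cong:
  assumes "\<And>k. k \<in> K \<Longrightarrow> P k = P' k" "\<And>v. v \<in> S \<Longrightarrow> z v = z' v"
  shows "splittable S K P z \<longleftrightarrow> splittable S K P' z'"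
  using assms by (simp add: splittable_def)

lemma splittable_single: "splittable {v} {} P z \<longleftrightarrow> 0 \<le> z v"
  by (simp add: splittable_def)

text \<open>
  The leaf \<open>v\<close> hands all of \<open>z v\<close> to its only edge, which then draws as little as possible from
  the other endpoint \<open>u\<close>.
\<close>

lemma splittable_insert:
  assumes tree: "grown_tree S K" and u: "u \<in> S" and v: "v \<notin> S"
  shows "splittable (insert v S) (insert {u, v} K) P z \<longleftrightarrow>
    - P {u, v} \<le> z v \<and> splittable S K P (z(u := z u + min (P {u, v}) (z v)))"
    (is "?L \<longleftrightarrow> ?c \<and> splittable S K P ?z")
proof -
  let ?k = "{u, v}"
  have uv: "u \<noteq> v" and k: "?k \<notin> K" and fin: "finite K" and K: "\<And>k. k \<in> K \<Longrightarrow> v \<notin> k"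
    using grown_tree_facts[OF tree] u v by auto
  have sum_v: "(\<Sum>k | k \<in> insert ?k K \<and> v \<in> k. f k) = f ?k" for f :: "'a set \<Rightarrow> real"
  proof -
    have "{k. k \<in> insert ?k K \<and> v \<in> k} = {?k}"
      using K by auto
    then show ?thesis
      by simp
  qed
  have sum_u: "(\<Sum>k | k \<in> insert ?k K \<and> u \<in> k. f k) = f ?k + (\<Sum>k | k \<in> K \<and> u \<in> k. f k)"
    for f :: "'a set \<Rightarrow> real"
  proof -
    have "{k. k \<in> insert ?k K \<and> u \<in> k} = insert ?k {k. k \<in> K \<and> u \<in> k}"
      by auto
    then show ?thesis
      using k fin by simp
  qed
  have sum_x: "(\<Sum>k | k \<in> insert ?k K \<and> x \<in> k. f k) = (\<Sum>k | k \<in> K \<and> x \<in> k. f k)"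
    if "x \<noteq> u" "x \<noteq> v" for f :: "'a set \<Rightarrow> real" and x
    by (rule sum.cong) (use that in auto)
  show ?thesis
  proof
    assume ?L
    then obtain w where w: "\<forall>k\<in>insert ?k K. (\<forall>v\<in>k. - P k \<le> w k v) \<and> 0 \<le> sum (w k) k"
      and z: "\<forall>x\<in>insert v S. (\<Sum>k | k \<in> insert ?k K \<and> x \<in> k. w k x) \<le> z x"
      unfolding splittable_def by blast
    have zv: "w ?k v \<le> z v"
      using z sum_v[of "\<lambda>k. w k v"] by auto
    have wk: "- P ?k \<le> w ?k u" "- P ?k \<le> w ?k v" "0 \<le> w ?k u + w ?k v"
      using w uv by auto
    have "(\<Sum>k | k \<in> K \<and> x \<in> k. w k x) \<le> ?z x" if "x \<in> S" for x
    proof (cases "x = u")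
      case True
      \<comment> \<open>\<open>w ?k u\<close> is at least \<open>- P ?k\<close> and at least
        \<open>- w ?k v \<ge> - z v\<close>, hence at least
        \<open>- min (P ?k) (z v)\<close>.\<close>
      have "w ?k u + (\<Sum>k | k \<in> K \<and> u \<in> k. w k u) \<le> z u"
        using z u sum_u[of "\<lambda>k. w k u"] by auto
      then show ?thesis
        using wk zv True by auto
    next
      case False
      then have "(\<Sum>k | k \<in> K \<and> x \<in> k. w k x) = (\<Sum>k | k \<in> insert ?k K \<and> x \<in> k. w k x)"
        using that v by (intro sum_x[symmetric]) auto
      also have "\<dots> \<le> z x"
        using z that by blast
      finally show ?thesis
        using False by simp
    qed
    then have "splittable S K P ?z"
      unfolding splittable_def using w by blast
    then show "?c \<and> splittable S K P ?z"
      using wk zv by linarith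
  next
    assume R: "?c \<and> splittable S K P ?z"
    then obtain w where w: "\<forall>k\<in>K. (\<forall>v\<in>k. - P k \<le> w k v) \<and> 0 \<le> sum (w k) k"
      and z: "\<forall>x\<in>S. (\<Sum>k | k \<in> K \<and> x \<in> k. w k x) \<le> ?z x"
      unfolding splittable_def by blast
    \<comment> \<open>With \<open>z v\<close> at the leaf, the value at \<open>u\<close> is bounded
      below by \<open>- P ?k\<close> and \<open>- z v\<close>; the larger bound is
      \<open>- min (P ?k) (z v)\<close>.\<close>
    define w' where "w' = w(?k := (\<lambda>x. if x = v then z v else - min (P ?k) (z v)))"
    have w'k: "w' ?k v = z v" "w' ?k u = - min (P ?k) (z v)"
      using uv by (auto simp: w'_def)
    have w'K: "w' k = w k" if "k \<in> K" for k
      using that k by (auto simp: w'_def)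
    have 1: "(\<forall>x\<in>k. - P k \<le> w' k x) \<and> 0 \<le> sum (w' k) k" if "k \<in> insert ?k K" for k
    proof (cases "k = ?k")
      case True
      then show ?thesis
        using w'k uv R by auto
    next
      case False
      then show ?thesis
        using that w w'K by auto
    qed
    have 2: "(\<Sum>k | k \<in> insert ?k K \<and> x \<in> k. w' k x) \<le> z x" if x: "x \<in> insert v S" for x
    proof -
      have eq: "(\<Sum>k | k \<in> K \<and> x \<in> k. w' k x) = (\<Sum>k | k \<in> K \<and> x \<in> k. w k x)"
        by (rule sum.cong) (auto simp: w'K)
      consider "x = v" | "x = u" | "x \<in> S" "x \<noteq> u" "x \<noteq> v"
        using x v by blast
      then show ?thesis
      proof cases
        case 1
        show ?thesis
          unfolding 1 by (simp only: sum_v[of "\<lambda>k. w' k v"] w'k order.refl)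
      next
        case 2
        have "(\<Sum>k | k \<in> K \<and> u \<in> k. w k u) \<le> ?z u"
          using z u by blast
        then have "(\<Sum>k | k \<in> K \<and> u \<in> k. w k u) \<le> z u + min (P ?k) (z v)"
          by (simp only: fun_upd_same)
        then show ?thesis
          using eq unfolding 2 by (simp only: sum_u[of "\<lambda>k. w' k u"] w'k)
      next
        case 3
        then have "(\<Sum>k | k \<in> K \<and> x \<in> k. w k x) \<le> ?z x"
          using z by blast
        moreover have "?z x = z x"
          using 3 by simp
        ultimately show ?thesis
          using eq sum_x[OF 3(2,3), of "\<lambda>k. w' k x"] by linarith
      qed
    qed
    show ?L
      unfolding splittable_def by (intro exI[of _ w'] conjI ballI) (use 1 2 in blast)+
  qed
qed

section \<open>Integer points over a tree\<close>

definition edges_in :: "('e \<Rightarrow> 'v set) \<Rightarrow> 'v set set \<Rightarrow> 'e set" where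
  "edges_in ends K = {e. ends e \<in> K}"

definition pos_sum :: "('e::finite \<Rightarrow> 'v set) \<Rightarrow> ('e \<Rightarrow> int) \<Rightarrow> 'v set \<Rightarrow> int" where
  "pos_sum ends y k = (\<Sum>e\<in>edges_in ends {k}. max 0 (y e))"

text \<open>Here \<open>z\<close> holds the vertex coordinates after removal of the negative parts
  of the edge coordinates. Only \<open>z\<close> and \<open>y\<close> are integral; the splitting
  inside \<open>splittable\<close> may be real.\<close>

definition points :: "('e::finite \<Rightarrow> 'v set) \<Rightarrow> 'v set \<Rightarrow> 'v set set \<Rightarrow> (('v \<Rightarrow> int) \<times> ('e \<Rightarrow> int)) set" where
  "points ends S K = {(z, y). z \<in> supported S \<and> y \<in> supported (edges_in ends K) \<and>
     splittable S K (\<lambda>k. of_int (pos_sum ends y k)) (\<lambda>v. of_int (z v))}"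

text \<open>For \<open>S = UNIV\<close> this is the coordinate sum of the encoded lattice point: a
  negative part is restored at both endpoints, and
  \<open>2 * max 0 (- y) + y = \<bar>y\<bar>\<close>.\<close>

definition height :: "('v \<Rightarrow> int) \<times> ('e::finite \<Rightarrow> int) \<Rightarrow> 'v set \<Rightarrow> int" where
  "height p S = sum (fst p) S + (\<Sum>e\<in>UNIV. \<bar>snd p e\<bar>)"

definition restrict0 :: "'e set \<Rightarrow> ('e \<Rightarrow> int) \<Rightarrow> 'e \<Rightarrow> int" where
  "restrict0 B y e = (if e \<in> B then y e else 0)"

text \<open>By \<open>splittable_insert\<close> the conditions separate into a bound on the leaf and
  feasibility on the smaller tree. The shift of \<open>z u\<close> is an integer determined by the
  removed data, so it can be undone.\<close>

lemma bij_betw_points_insert: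
  fixes ends :: "'e::finite \<Rightarrow> 'v set"
  assumes tree: "grown_tree S K" and u: "u \<in> S" and v: "v \<notin> S"
  defines "k \<equiv> {u, v}"
  shows "bij_betw (\<lambda>(z, y). ((z(v := 0, u := z u + min (pos_sum ends y k) (z v)),
        restrict0 (edges_in ends K) y), (restrict0 (edges_in ends {k}) y, z v)))
      (points ends (insert v S) (insert k K)) (points ends S K \<times> leaves (edges_in ends {k}))"
    (is "bij_betw ?f ?X (?Y \<times> ?L)")
proof -
  \<comment> \<open>The inverse map. The supports of \<open>y\<close> and \<open>y'\<close> are
    disjoint sets of edges, so their sum glues them.\<close>
  let ?g = "\<lambda>((z, y), (y', c)). (z(v := c, u := z u - min (pos_sum ends y' k) c), \<lambda>e. y e + y' e :: int)"
  have uv: "u \<noteq> v" and k: "k \<notin> K"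
    using grown_tree_facts[OF tree] u v by (auto simp: k_def)
  have ps1: "pos_sum ends (restrict0 (edges_in ends K) y) k' = pos_sum ends y k'" if "k' \<in> K" for k' y
    unfolding pos_sum_def by (rule sum.cong) (use that in \<open>auto simp: restrict0_def edges_in_def\<close>)
  have ps2: "pos_sum ends (restrict0 (edges_in ends {k}) y) k = pos_sum ends y k" for y
    unfolding pos_sum_def by (rule sum.cong) (auto simp: restrict0_def edges_in_def)
  have ps3: "pos_sum ends (\<lambda>e. y e + y' e) k' = pos_sum ends y k'"
    if "k' \<in> K" "y' \<in> supported (edges_in ends {k})" for k' y y'
    unfolding pos_sum_def
    by (rule sum.cong) (use that k in \<open>auto simp: supported_def edges_in_def\<close>)
  have ps4: "pos_sum ends (\<lambda>e. y e + y' e) k = pos_sum ends y' k"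
    if "y \<in> supported (edges_in ends K)" for y y'
    unfolding pos_sum_def
    by (rule sum.cong) (use that k in \<open>auto simp: supported_def edges_in_def\<close>)
  have split: "splittable (insert v S) (insert k K) (\<lambda>k. of_int (pos_sum ends y k)) (\<lambda>x. of_int (z x)) \<longleftrightarrow>
      - pos_sum ends y k \<le> z v \<and> splittable S K (\<lambda>k. of_int (pos_sum ends y k))
        (\<lambda>x. of_int ((z(u := z u + min (pos_sum ends y k) (z v))) x))" for y z
  proof -
    have "(\<lambda>x. real_of_int ((z(u := z u + min (pos_sum ends y k) (z v))) x)) =
        (\<lambda>x. real_of_int (z x))(u := real_of_int (z u) + min (real_of_int (pos_sum ends y k)) (real_of_int (z v)))"
      by (auto simp: fun_eq_iff of_int_min)
    moreover have "- pos_sum ends y k \<le> z v \<longleftrightarrow> - real_of_int (pos_sum ends y k) \<le> real_of_int (z v)"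
      by linarith
    ultimately show ?thesis
      using splittable_insert[OF tree u v, of "\<lambda>k. of_int (pos_sum ends y k)" "\<lambda>x. of_int (z x)"]
      unfolding k_def by simp
  qed
  have L: "(y, c) \<in> ?L \<longleftrightarrow> y \<in> supported (edges_in ends {k}) \<and> - pos_sum ends y k \<le> c" for y c
    by (simp add: leaves_def pos_sum_def)
  have to: "?f (z, y) \<in> ?Y \<times> ?L" if "(z, y) \<in> ?X" for z y
  proof -
    have zy: "z \<in> supported (insert v S)" "y \<in> supported (edges_in ends (insert k K))"
      "- pos_sum ends y k \<le> z v" "splittable S K (\<lambda>k. of_int (pos_sum ends y k))
        (\<lambda>x. of_int ((z(u := z u + min (pos_sum ends y k) (z v))) x))"
      using that unfolding points_def by (auto simp only: split mem_Collect_eq prod.case)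
    have "splittable S K (\<lambda>k. of_int (pos_sum ends (restrict0 (edges_in ends K) y) k))
        (\<lambda>x. of_int ((z(v := 0, u := z u + min (pos_sum ends y k) (z v))) x))"
      by (rule splittable_cong[THEN iffD1, OF _ _ zy(4)]) (use v uv in \<open>auto simp: ps1\<close>)
    moreover have "z(v := 0, u := z u + min (pos_sum ends y k) (z v)) \<in> supported S"
      using zy(1) u by (auto simp: supported_def)
    moreover have "restrict0 (edges_in ends K) y \<in> supported (edges_in ends K)"
      "restrict0 (edges_in ends {k}) y \<in> supported (edges_in ends {k})"
      by (auto simp: supported_def restrict0_def)
    ultimately show ?thesis
      using zy(3) by (simp only: prod.case mem_Times_iff fst_conv snd_conv L ps2) (simp add: points_def)
  qed
  have from1: "?g ((z, y), (y', c)) \<in> ?X" if "(z, y) \<in> ?Y" "(y', c) \<in> ?L" for z y y' c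
  proof -
    have zy: "z \<in> supported S" "y \<in> supported (edges_in ends K)"
      "splittable S K (\<lambda>k. of_int (pos_sum ends y k)) (\<lambda>x. of_int (z x))"
      using that(1) by (auto simp: points_def)
    have yc: "y' \<in> supported (edges_in ends {k})" "- pos_sum ends y' k \<le> c"
      using that(2) L by auto
    let ?z = "z(v := c, u := z u - min (pos_sum ends y' k) c)" and ?y = "\<lambda>e. y e + y' e"
    have "splittable S K (\<lambda>k. of_int (pos_sum ends ?y k))
        (\<lambda>x. of_int ((?z(u := ?z u + min (pos_sum ends ?y k) (?z v))) x))"
      by (rule splittable_cong[THEN iffD1, OF _ _ zy(3)])
        (use v uv in \<open>auto simp: ps3[OF _ yc(1)] ps4[OF zy(2)]\<close>)
    moreover have "- pos_sum ends ?y k \<le> ?z v"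
      using yc uv by (simp add: ps4[OF zy(2)])
    ultimately have "splittable (insert v S) (insert k K) (\<lambda>k. of_int (pos_sum ends ?y k)) (\<lambda>x. of_int (?z x))"
      using split by blast
    moreover have "?z \<in> supported (insert v S)"
      using zy(1) u by (auto simp: supported_def)
    moreover have "?y \<in> supported (edges_in ends (insert k K))"
      using zy(2) yc(1) by (auto simp: supported_def edges_in_def)
    ultimately show ?thesis
      by (simp only: points_def prod.case mem_Collect_eq simp_thms)
  qed
  have gf: "?g (?f (z, y)) = (z, y)" if "(z, y) \<in> ?X" for z y
  proof -
    have "y \<in> supported (edges_in ends (insert k K))"
      using that by (auto simp: points_def)
    then have "restrict0 (edges_in ends K) y e + restrict0 (edges_in ends {k}) y e = y e" for e
      using k by (auto simp: supported_def edges_in_def restrict0_def)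
    then show ?thesis
      using uv by (simp add: ps2 fun_eq_iff)
  qed
  have fg: "?f (?g ((z, y), (y', c))) = ((z, y), (y', c))" if "(z, y) \<in> ?Y" "(y', c) \<in> ?L" for z y y' c
  proof -
    have z: "z v = 0" and y: "y \<in> supported (edges_in ends K)" and y': "y' \<in> supported (edges_in ends {k})"
      using that L v by (auto simp: points_def supported_def)
    have "restrict0 (edges_in ends K) (\<lambda>e. y e + y' e) = y"
      "restrict0 (edges_in ends {k}) (\<lambda>e. y e + y' e) = y'"
      using k y y' by (auto simp: supported_def edges_in_def restrict0_def fun_eq_iff)
    then show ?thesis
      using uv z by (simp add: ps4[OF y] fun_eq_iff)
  qed
  show ?thesis
  proof (rule bij_betw_byWitness[where f' = ?g])
    show "\<forall>p\<in>?X. ?g (?f p) = p"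
    proof
      fix p assume "p \<in> ?X"
      then show "?g (?f p) = p"
        using gf[of "fst p" "snd p"] by (simp only: prod.collapse)
    qed
    show "\<forall>p\<in>?Y \<times> ?L. ?f (?g p) = p"
    proof
      fix p assume "p \<in> ?Y \<times> ?L"
      then show "?f (?g p) = p"
        using fg[of "fst (fst p)" "snd (fst p)" "fst (snd p)" "snd (snd p)"]
        by (simp only: prod.collapse mem_Times_iff)
    qed
    show "?f ` ?X \<subseteq> ?Y \<times> ?L"
    proof (rule image_subsetI)
      fix p assume "p \<in> ?X"
      then show "?f p \<in> ?Y \<times> ?L"
        using to[of "fst p" "snd p"] by (simp only: prod.collapse)
    qed
    show "?g ` (?Y \<times> ?L) \<subseteq> ?X"
    proof (rule image_subsetI)
      fix p assume "p \<in> ?Y \<times> ?L"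
      then show "?g p \<in> ?X"
        using from1[of "fst (fst p)" "snd (fst p)" "fst (snd p)" "snd (snd p)"]
        by (simp only: prod.collapse mem_Times_iff)
    qed
  qed
qed

text \<open>The sum over \<open>S\<close> gains \<open>min P (z v)\<close>, exactly what
  \<open>leaf_weight\<close> omits from \<open>z v\<close>; the absolute values split because the
  edge sets are disjoint.\<close>

lemma height_insert:
  fixes ends :: "'e::finite \<Rightarrow> 'v set"
  assumes "finite S" "u \<in> S" "v \<notin> S" "k \<notin> K" "y \<in> supported (edges_in ends (insert k K))"
  shows "height (z(v := 0, u := z u + min (pos_sum ends y k) (z v)), restrict0 (edges_in ends K) y) S
      + leaf_weight (edges_in ends {k}) (restrict0 (edges_in ends {k}) y, z v) = height (z, y) (insert v S)"
proof -
  let ?m = "min (pos_sum ends y k) (z v)"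
  have "sum (z(v := 0, u := z u + ?m)) S = (z u + ?m) + sum (z(v := 0, u := z u + ?m)) (S - {u})"
    using assms(1,2) by (subst sum.remove[of S u]) auto
  also have "sum (z(v := 0, u := z u + ?m)) (S - {u}) = sum z (S - {u})"
    by (rule sum.cong) (use assms in auto)
  also have "z u + ?m + sum z (S - {u}) = sum z S + ?m"
    using assms(1,2) by (simp add: sum.remove[of S u])
  finally have z: "sum (z(v := 0, u := z u + ?m)) S = sum z S + ?m" .
  have y1: "(\<Sum>e\<in>edges_in ends {k}. \<bar>restrict0 (edges_in ends {k}) y e\<bar>) =
      (\<Sum>e\<in>UNIV. \<bar>restrict0 (edges_in ends {k}) y e\<bar>)"
    by (rule sum.mono_neutral_left) (auto simp: restrict0_def)
  have y2: "(\<Sum>e\<in>UNIV. \<bar>restrict0 (edges_in ends K) y e\<bar>) + (\<Sum>e\<in>UNIV. \<bar>restrict0 (edges_in ends {k}) y e\<bar>) =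
      (\<Sum>e\<in>UNIV. \<bar>y e\<bar>)"
    unfolding sum.distrib[symmetric]
    by (rule sum.cong) (use assms(4,5) in \<open>auto simp: restrict0_def edges_in_def supported_def\<close>)
  have "(\<Sum>e\<in>edges_in ends {k}. max 0 (restrict0 (edges_in ends {k}) y e)) = pos_sum ends y k"
    unfolding pos_sum_def by (rule sum.cong) (auto simp: restrict0_def)
  then have "leaf_weight (edges_in ends {k}) (restrict0 (edges_in ends {k}) y, z v) =
      (\<Sum>e\<in>UNIV. \<bar>restrict0 (edges_in ends {k}) y e\<bar>) + (z v - ?m)"
    by (simp add: leaf_weight_def y1)
  then show ?thesis
    using z y2 assms(1,3) by (simp add: height_def del: fun_upd_apply)
qed

text \<open>A single vertex gives 1 / (1 - q), and each new leaf multiplies by the series of its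
  multi-edge. The denominator is multiplied out, its exponent being the number of vertices plus the
  number of edges.\<close>

lemma has_gf_points:
  fixes ends :: "'e::finite \<Rightarrow> 'v set"
  assumes "grown_tree S K" "K \<subseteq> range ends"
  shows "\<exists>F. has_gf (points ends S K) (\<lambda>p. height p S) (\<lambda>_. 1) F \<and>
    F * (1 - fps_X) ^ (card S + card (edges_in ends K)) = (\<Prod>k\<in>K. edge_factor (card (edges_in ends {k})))"
  using assms
proof (induction)
  case (single v)
  have "points ends {v} {} = (\<lambda>c. ((\<lambda>_. 0)(v := c), \<lambda>_. 0)) ` {0..}"
    by (auto simp: points_def splittable_single supported_def edges_in_def fun_eq_iff image_iff)
  then have "bij_betw (\<lambda>(z, y). z v) (points ends {v} {}) {0..}"
    by (intro bij_betw_byWitness[where f' = "\<lambda>c. ((\<lambda>_. 0)(v := c), \<lambda>_. 0)"]) auto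
  moreover have "height p {v} = (\<lambda>(z, y). z v) p" if "p \<in> points ends {v} {}" for p
    using that by (auto simp: height_def points_def supported_def edges_in_def)
  ultimately have "has_gf (points ends {v} {}) (\<lambda>p. height p {v}) (\<lambda>_. 1) gf_ray"
    by (intro has_gf_bij[OF has_gf_ray]) auto
  then show ?case
    using gf_ray_eq by (auto simp: edges_in_def)
next
  case (grow S K u v)
  let ?k = "{u, v}"
  let ?b = "card (edges_in ends {?k})"
  obtain F where F: "has_gf (points ends S K) (\<lambda>p. height p S) (\<lambda>_. 1) F"
    "F * (1 - fps_X) ^ (card S + card (edges_in ends K)) = (\<Prod>k\<in>K. edge_factor (card (edges_in ends {k})))"
    using grow by auto
  have K: "?k \<notin> K" "finite S" "finite K"
    using grown_tree_facts[OF grow.hyps(1)] grow.hyps by auto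
  let ?G = "gf_line ^ ?b * gf_ray + of_nat ?b * gf_pos * gf_line ^ (?b - 1)"
  have "has_gf (points ends (insert v S) (insert ?k K)) (\<lambda>p. height p (insert v S)) (\<lambda>_. 1) (F * ?G)"
    by (rule has_gf_bij[OF has_gf_times[OF F(1) has_gf_leaves] bij_betw_points_insert[OF grow.hyps]])
      (use grow.hyps K in \<open>auto simp: points_def intro!: height_insert simp del: fun_upd_apply\<close>)
  moreover have "F * ?G * (1 - fps_X) ^ (card (insert v S) + card (edges_in ends (insert ?k K))) =
      (\<Prod>k\<in>insert ?k K. edge_factor (card (edges_in ends {k})))"
  proof -
    have "edges_in ends (insert ?k K) = edges_in ends {?k} \<union> edges_in ends K"
      by (auto simp: edges_in_def)
    moreover have "edges_in ends {?k} \<inter> edges_in ends K = {}"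
      using K by (auto simp: edges_in_def)
    ultimately have c: "card (insert v S) + card (edges_in ends (insert ?k K)) =
        (card S + card (edges_in ends K)) + Suc ?b"
      using grow.hyps K by (simp add: card_Un_disjoint)
    \<comment> \<open>\<open>K \<subseteq> range ends\<close> makes every multi-edge nonempty, as
      \<open>leaves_gf_eq\<close> requires.\<close>
    have "?b \<ge> 1"
    proof -
      have "edges_in ends {?k} \<noteq> {}"
        using grow.prems by (auto simp: edges_in_def)
      then show ?thesis
        by (simp add: Suc_leI card_gt_0_iff)
    qed
    then have "?G * (1 - fps_X) ^ Suc ?b = edge_factor ?b"
      by (rule leaves_gf_eq)
    moreover have "F * ?G * (1 - fps_X) ^ (card (insert v S) + card (edges_in ends (insert ?k K))) =
        (F * (1 - fps_X) ^ (card S + card (edges_in ends K))) * (?G * (1 - fps_X) ^ Suc ?b)"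
      unfolding c power_add by (simp only: mult_ac)
    ultimately show ?thesis
      using K by (simp add: F(2) mult.commute)
  qed
  ultimately show ?case
    by blast
qed

section \<open>Spanning trees\<close>

text \<open>Greedy growth: while \<open>S\<close> misses a vertex, a walk from inside to outside
  \<open>S\<close> crosses along some edge, which is attached as the next leaf.\<close>

lemma connected_grown_tree:
  fixes ends :: "'e::finite \<Rightarrow> 'v::finite set"
  assumes "connected_graph ends"
  shows "\<exists>K \<subseteq> range ends. grown_tree UNIV K"
proof -
  have "\<exists>S K. grown_tree S K \<and> K \<subseteq> range ends \<and> card S = Suc m" if "m < CARD('v)" for m
    using that
  proof (induction m)
    case 0
    show ?case
      using grown_tree.single by fastforce
  next
    case (Suc m)
    then obtain S K where S: "grown_tree S K" "K \<subseteq> range ends" "card S = Suc m"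
      by auto
    have "S \<noteq> UNIV"
      using S Suc.prems by auto
    then obtain y where y: "y \<notin> S"
      by blast
    obtain x where x: "x \<in> S"
      using grown_tree_facts[OF S(1)] by blast
    have "(adjacent ends)\<^sup>*\<^sup>* x y"
      using assms by (auto simp: connected_graph_def)
    then have "\<exists>u v. u \<in> S \<and> v \<notin> S \<and> adjacent ends u v"
      using x y by (induction rule: rtranclp_induct) auto
    then obtain u v e where uv: "u \<in> S" "v \<notin> S" "ends e = {u, v}"
      by (auto simp: adjacent_def)
    have "grown_tree (insert v S) (insert {u, v} K)"
      using S uv by (intro grown_tree.grow)
    moreover have "insert {u, v} K \<subseteq> range ends"
      using S uv by (metis insert_subset rangeI)
    ultimately show ?case
      using S uv grown_tree_facts(1)[OF S(1)] by (metis card_insert_disjoint)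
  qed
  from this[of "CARD('v) - 1"] obtain S K where S: "grown_tree S K" "K \<subseteq> range ends" "card S = CARD('v)"
    by (auto simp: Suc_diff_Suc)
  then have "S = (UNIV :: 'v set)"
    by (intro card_subset_eq) auto
  then show ?thesis
    using S by auto
qed

subsection \<open>Lattice points of the polytope\<close>

text \<open>Divided by \<open>s + t\<close>, the sum is a convex combination of points of
  \<open>C\<close>; if \<open>s + t = 0\<close>, everything is 0.\<close>

lemma scaled_convex_add:
  fixes C :: "'a::real_vector set"
  assumes "convex C" "0 \<le> s" "0 \<le> t" "x \<in> (*\<^sub>R) s ` C" "y \<in> (*\<^sub>R) t ` C"
  shows "x + y \<in> (*\<^sub>R) (s + t) ` C"
proof (cases "s + t = 0")
  case True
  then have "s = 0" "t = 0"
    using assms by auto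
  then show ?thesis
    using assms by auto
next
  case False
  obtain c d where c: "c \<in> C" "x = s *\<^sub>R c" and d: "d \<in> C" "y = t *\<^sub>R d"
    using assms by auto
  have "(s / (s + t)) *\<^sub>R c + (t / (s + t)) *\<^sub>R d \<in> C"
    using assms c d False by (intro convexD) (auto simp: add_divide_distrib[symmetric])
  moreover have "x + y = (s + t) *\<^sub>R ((s / (s + t)) *\<^sub>R c + (t / (s + t)) *\<^sub>R d)"
    using False by (simp add: c d scaleR_add_right)
  ultimately show ?thesis
    by blast
qed

lemma scaled_convex_sum:
  fixes C :: "'a::real_vector set"
  assumes "convex C" "C \<noteq> {}" "finite I" "\<And>i. i \<in> I \<Longrightarrow> 0 \<le> s i" "\<And>i. i \<in> I \<Longrightarrow> f i \<in> (*\<^sub>R) (s i) ` C"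
  shows "sum f I \<in> (*\<^sub>R) (sum s I) ` C"
  using assms(3-5)
proof (induction I)
  case empty
  then show ?case
    using assms(2) by (auto simp: image_iff)
next
  case (insert i I)
  then show ?case
    by (simp add: scaled_convex_add[OF assms(1)] sum_nonneg)
qed

section \<open>Edge cones and dilates of the polytope\<close>

text \<open>\<open>u e\<close> is the share of the vertex coordinates given to \<open>e\<close>,
  subject to the cone conditions of that edge. Vertices carry an inequality because a surplus can go
  to any incident edge without leaving its cone.\<close>

definition edge_decomposable :: "('e::finite \<Rightarrow> 'v::finite set) \<Rightarrow> ('e \<Rightarrow> real) \<Rightarrow> ('v \<Rightarrow> real) \<Rightarrow> bool" where
  "edge_decomposable ends y x \<longleftrightarrow> (\<exists>u. (\<forall>e. (\<forall>v\<in>ends e. - y e \<le> u e v) \<and> 0 \<le> sum (u e) (ends e)) \<and>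
     (\<forall>v. (\<Sum>e | v \<in> ends e. u e v) \<le> x v))"

text \<open>The three generators belonging to \<open>f\<close> are the sign patterns with exactly
  one -1.\<close>

definition edge_part :: "'e \<Rightarrow> 'v \<Rightarrow> 'v \<Rightarrow> real \<Rightarrow> real \<Rightarrow> real \<Rightarrow> real ^ ('v::finite + 'e::finite)" where
  "edge_part f i j a b c = a *\<^sub>R vertex_vec i + b *\<^sub>R vertex_vec j + c *\<^sub>R edge_vec f"

lemma edge_part_nth:
  "edge_part f i j a b c $ Inl v = (if v = i then a else 0) + (if v = j then b else 0)"
  "edge_part f i j a b c $ Inr e = (if e = f then c else 0)"
  by (auto simp: edge_part_def vertex_vec_def edge_vec_def axis_def)

lemma sum_UNIV_Plus:
  fixes g :: "'v::finite + 'e::finite \<Rightarrow> 'a::comm_monoid_add"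
  shows "sum g UNIV = (\<Sum>v\<in>UNIV. g (Inl v)) + (\<Sum>e\<in>UNIV. g (Inr e))"
  by (simp add: UNIV_Plus_UNIV[symmetric] sum.Plus del: UNIV_Plus_UNIV)

lemma edge_decomposable_edge_part:
  assumes "ends f = {i, j}" "i \<noteq> j" "0 \<le> a + b" "0 \<le> a + c" "0 \<le> b + c"
  shows "edge_decomposable ends (\<lambda>e. edge_part f i j a b c $ Inr e) (\<lambda>v. edge_part f i j a b c $ Inl v)"
proof -
  \<comment> \<open>The value \<open>b\<close> is only ever read at \<open>j\<close>.\<close>
  define u where "u e v = (if e = f then (if v = i then a else b) else 0)" for e v
  have "(\<Sum>e | v \<in> ends e. u e v) = (if v \<in> ends f then (if v = i then a else b) else 0)" for v
    by (simp add: u_def)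
  moreover have "0 \<le> sum (u e) (ends e)" for e
    using assms by (cases "e = f") (auto simp: u_def)
  ultimately show ?thesis
    unfolding edge_decomposable_def edge_part_nth
    by (intro exI[of _ u] conjI allI) (use assms in \<open>auto simp: u_def\<close>)
qed

lemma cosmological_polytope_edge_part:
  "cosmological_polytope ends = convex hull
    (\<Union>{ {edge_part f i j 1 1 (-1), edge_part f i j 1 (-1) 1, edge_part f i j (-1) 1 1} | f i j. ends f = {i, j} })"
  by (simp add: cosmological_polytope_def edge_part_def)

lemma edge_part_in_polytope:
  assumes "ends f = {i, j}"
  shows "edge_part f i j 1 1 (-1) \<in> cosmological_polytope ends"
    "edge_part f i j 1 (-1) 1 \<in> cosmological_polytope ends"
    "edge_part f i j (-1) 1 1 \<in> cosmological_polytope ends"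
  unfolding cosmological_polytope_edge_part by (rule hull_inc, use assms in blast)+

text \<open>All conditions are linear in the point and its splitting jointly, so the splittings are
  combined with the same weights as the points.\<close>

lemma convex_edge_decomposable:
  "convex {x :: real ^ ('v::finite + 'e::finite). (\<Sum>k\<in>UNIV. x $ k) = 1 \<and>
     edge_decomposable ends (\<lambda>e. x $ Inr e) (\<lambda>v. x $ Inl v)}"
  unfolding convex_def
proof (intro ballI allI impI, elim CollectE conjE, intro CollectI conjI)
  fix x y :: "real ^ ('v + 'e)" and s t :: real
  assume st: "0 \<le> s" "0 \<le> t" "s + t = 1"
    and sx: "(\<Sum>k\<in>UNIV. x $ k) = 1" and sy: "(\<Sum>k\<in>UNIV. y $ k) = 1"
    and "edge_decomposable ends (\<lambda>e. x $ Inr e) (\<lambda>v. x $ Inl v)"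
    and "edge_decomposable ends (\<lambda>e. y $ Inr e) (\<lambda>v. y $ Inl v)"
  then obtain u u' where u: "\<And>e v. v \<in> ends e \<Longrightarrow> - x $ Inr e \<le> u e v" "\<And>e. 0 \<le> sum (u e) (ends e)"
      "\<And>v. (\<Sum>e | v \<in> ends e. u e v) \<le> x $ Inl v"
    and u': "\<And>e v. v \<in> ends e \<Longrightarrow> - y $ Inr e \<le> u' e v" "\<And>e. 0 \<le> sum (u' e) (ends e)"
      "\<And>v. (\<Sum>e | v \<in> ends e. u' e v) \<le> y $ Inl v"
    unfolding edge_decomposable_def by blast
  show "(\<Sum>k\<in>UNIV. (s *\<^sub>R x + t *\<^sub>R y) $ k) = 1"
    using sx sy st by (simp add: sum.distrib sum_distrib_left[symmetric])
  show "edge_decomposable ends (\<lambda>e. (s *\<^sub>R x + t *\<^sub>R y) $ Inr e) (\<lambda>v. (s *\<^sub>R x + t *\<^sub>R y) $ Inl v)"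
    unfolding edge_decomposable_def
  proof (intro exI[of _ "\<lambda>e v. s * u e v + t * u' e v"] conjI allI ballI)
    show "- (s *\<^sub>R x + t *\<^sub>R y) $ Inr e \<le> s * u e v + t * u' e v" if "v \<in> ends e" for e v
      using mult_left_mono[OF u(1)[OF that] st(1)] mult_left_mono[OF u'(1)[OF that] st(2)] by simp
    show "0 \<le> (\<Sum>v\<in>ends e. s * u e v + t * u' e v)" for e
      using u(2) u'(2) st by (simp add: sum.distrib sum_distrib_left[symmetric])
    show "(\<Sum>e | v \<in> ends e. s * u e v + t * u' e v) \<le> (s *\<^sub>R x + t *\<^sub>R y) $ Inl v" for v
      using mult_left_mono[OF u(3)[of v] st(1)] mult_left_mono[OF u'(3)[of v] st(2)]
      by (simp add: sum.distrib sum_distrib_left[symmetric])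
  qed
qed

lemma polytope_subset_edge_decomposable:
  assumes "loopless ends"
  shows "cosmological_polytope ends \<subseteq> {x. (\<Sum>k\<in>UNIV. x $ k) = 1 \<and>
     edge_decomposable ends (\<lambda>e. x $ Inr e) (\<lambda>v. x $ Inl v)}"
  unfolding cosmological_polytope_edge_part
proof (rule hull_minimal, safe)
  fix f i j
  assume f: "ends f = {i, j}"
  then have ij: "i \<noteq> j"
    using assms by (auto simp: loopless_def dest: spec[of _ f])
  have s: "(\<Sum>k\<in>UNIV. (edge_part f i j a b c :: real ^ ('b + 'a)) $ k) = a + b + c" for a b c
    by (simp add: sum_UNIV_Plus edge_part_nth sum.distrib)
  show "(\<Sum>k\<in>UNIV. (edge_part f i j 1 1 (-1) :: real ^ ('b + 'a)) $ k) = 1"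
    "(\<Sum>k\<in>UNIV. (edge_part f i j 1 (-1) 1 :: real ^ ('b + 'a)) $ k) = 1"
    "(\<Sum>k\<in>UNIV. (edge_part f i j (-1) 1 1 :: real ^ ('b + 'a)) $ k) = 1"
    by (simp_all add: s)
  show "edge_decomposable ends (\<lambda>e. edge_part f i j 1 1 (-1) $ Inr e) (\<lambda>v. edge_part f i j 1 1 (-1) $ Inl v)"
    "edge_decomposable ends (\<lambda>e. edge_part f i j 1 (-1) 1 $ Inr e) (\<lambda>v. edge_part f i j 1 (-1) 1 $ Inl v)"
    "edge_decomposable ends (\<lambda>e. edge_part f i j (-1) 1 1 $ Inr e) (\<lambda>v. edge_part f i j (-1) 1 1 $ Inl v)"
    by (rule edge_decomposable_edge_part[of ends f i j]; simp add: f ij)+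
qed (rule convex_edge_decomposable)

text \<open>The cone of one edge is simplicial: the coefficients (a + b) / 2, (a + c) / 2, (b + c) /
  2 express the vector in the three generators, are nonnegative by hypothesis and add up to a + b +
  c.\<close>

lemma edge_part_in_scaled:
  assumes f: "ends f = {i, j}" and "0 \<le> a + b" "0 \<le> a + c" "0 \<le> b + c"
  shows "edge_part f i j a b c \<in> (*\<^sub>R) (a + b + c) ` cosmological_polytope ends"
proof -
  have "((a + b) / 2) *\<^sub>R edge_part f i j 1 1 (-1) + ((a + c) / 2) *\<^sub>R edge_part f i j 1 (-1) 1 +
      ((b + c) / 2) *\<^sub>R edge_part f i j (-1) 1 1
      \<in> (*\<^sub>R) ((a + b) / 2 + (a + c) / 2 + (b + c) / 2) ` cosmological_polytope ends"
    by (intro scaled_convex_add imageI edge_part_in_polytope[of ends f i j, OF f])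
      (use assms in \<open>auto simp: cosmological_polytope_def\<close>)
  moreover have "((a + b) / 2) *\<^sub>R edge_part f i j 1 1 (-1) + ((a + c) / 2) *\<^sub>R edge_part f i j 1 (-1) 1 +
      ((b + c) / 2) *\<^sub>R edge_part f i j (-1) 1 1 = edge_part f i j a b c"
    (is "?l = ?r")
  proof -
    have "?l $ k = ?r $ k" for k
      by (cases k) (auto simp: edge_part_nth field_simps)
    then show ?thesis
      by (simp add: vec_eq_iff)
  qed
  moreover have "(a + b) / 2 + (a + c) / 2 + (b + c) / 2 = a + b + c"
    by (simp add: field_simps)
  ultimately show ?thesis
    by simp
qed

text \<open>Dilates are slices of the sum of the edge cones by the coordinate sum. For the converse,
  \<open>x\<close> is the sum of its edge parts, each in the dilate by its own coordinate sum, and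
  \<open>scaled_convex_sum\<close> adds up these factors.\<close>

lemma scaled_polytope_iff:
  fixes ends :: "'e::finite \<Rightarrow> 'v::finite set" and x :: "real ^ ('v + 'e)"
  assumes "loopless ends" and inc: "\<And>v. \<exists>e. v \<in> ends e" and "0 \<le> t"
  shows "x \<in> (*\<^sub>R) t ` cosmological_polytope ends \<longleftrightarrow>
    (\<Sum>k\<in>UNIV. x $ k) = t \<and> edge_decomposable ends (\<lambda>e. x $ Inr e) (\<lambda>v. x $ Inl v)"
proof
  assume "x \<in> (*\<^sub>R) t ` cosmological_polytope ends"
  then obtain c where x: "x = t *\<^sub>R c" and "c \<in> cosmological_polytope ends"
    by auto
  then have c: "(\<Sum>k\<in>UNIV. c $ k) = 1" "edge_decomposable ends (\<lambda>e. c $ Inr e) (\<lambda>v. c $ Inl v)"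
    using polytope_subset_edge_decomposable[OF assms(1)] by auto
  then obtain u where u: "\<And>e v. v \<in> ends e \<Longrightarrow> - c $ Inr e \<le> u e v" "\<And>e. 0 \<le> sum (u e) (ends e)"
      "\<And>v. (\<Sum>e | v \<in> ends e. u e v) \<le> c $ Inl v"
    unfolding edge_decomposable_def by blast
  have "edge_decomposable ends (\<lambda>e. x $ Inr e) (\<lambda>v. x $ Inl v)"
    unfolding edge_decomposable_def
  proof (intro exI[of _ "\<lambda>e v. t * u e v"] conjI allI ballI)
    show "- x $ Inr e \<le> t * u e v" if "v \<in> ends e" for e v
      using mult_left_mono[OF u(1)[OF that] assms(3)] by (simp add: x)
    show "0 \<le> (\<Sum>v\<in>ends e. t * u e v)" for e
      using u(2) assms(3) by (simp add: sum_distrib_left[symmetric])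
    show "(\<Sum>e | v \<in> ends e. t * u e v) \<le> x $ Inl v" for v
      using mult_left_mono[OF u(3)[of v] assms(3)] by (simp add: x sum_distrib_left)
  qed
  then show "(\<Sum>k\<in>UNIV. x $ k) = t \<and> edge_decomposable ends (\<lambda>e. x $ Inr e) (\<lambda>v. x $ Inl v)"
    using c by (simp add: x sum_distrib_left[symmetric])
next
  assume R: "(\<Sum>k\<in>UNIV. x $ k) = t \<and> edge_decomposable ends (\<lambda>e. x $ Inr e) (\<lambda>v. x $ Inl v)"
  then obtain u where u: "\<And>e v. v \<in> ends e \<Longrightarrow> - x $ Inr e \<le> u e v" "\<And>e. 0 \<le> sum (u e) (ends e)"
      "\<And>v. (\<Sum>e | v \<in> ends e. u e v) \<le> x $ Inl v"
    unfolding edge_decomposable_def by blast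
  obtain g where g: "\<And>v. v \<in> ends (g v)"
    using inc by metis
  text \<open>Any slack at a vertex is given to one of its edges.\<close>
  define d where "d v = x $ Inl v - (\<Sum>e | v \<in> ends e. u e v)" for v
  define u' where "u' e v = u e v + (if e = g v then d v else 0)" for e v
  have d: "0 \<le> d v" for v
    using u(3) by (simp add: d_def)
  have le: "u e v \<le> u' e v" for e v
    using d by (simp add: u'_def)
  have u'1: "- x $ Inr e \<le> u' e v" if "v \<in> ends e" for e v
    using u(1)[OF that] le by (rule order_trans)
  have u'2: "0 \<le> sum (u' e) (ends e)" for e
    using u(2) sum_mono[of "ends e" "u e" "u' e"] le by (meson order_trans)
  have u'3: "(\<Sum>e | v \<in> ends e. u' e v) = x $ Inl v" for v
    using g by (simp add: u'_def sum.distrib d_def)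
  obtain i j where ij: "\<And>e. ends e = {i e, j e}" "\<And>e. i e \<noteq> j e"
    using assms(1) unfolding loopless_def card_2_iff by metis
  define part :: "'e \<Rightarrow> real ^ ('v + 'e)"
    where "part e = edge_part e (i e) (j e) (u' e (i e)) (u' e (j e)) (x $ Inr e)" for e
  define s where "s e = u' e (i e) + u' e (j e) + x $ Inr e" for e
  have c: "0 \<le> u' e (i e) + u' e (j e)" "0 \<le> u' e (i e) + x $ Inr e" "0 \<le> u' e (j e) + x $ Inr e" for e
    using u'2[of e] u'1[of "i e" e] u'1[of "j e" e] ij by auto
  have part: "part e \<in> (*\<^sub>R) (s e) ` cosmological_polytope ends" for e
    unfolding part_def s_def by (rule edge_part_in_scaled) (use ij c in auto)
  have partv: "part e $ Inl v = (if v \<in> ends e then u' e v else 0)" for e v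
    using ij(1)[of e] ij(2)[of e] by (auto simp: part_def edge_part_nth)
  have "x = sum part UNIV"
  proof -
    have "x $ k = sum part UNIV $ k" for k
    proof (cases k)
      case (Inl v)
      then show ?thesis
        using u'3[of v] by (simp add: partv sum.If_cases)
    next
      case (Inr e)
      then show ?thesis
        by (simp add: part_def edge_part_nth)
    qed
    then show ?thesis
      by (simp add: vec_eq_iff)
  qed
  moreover have "sum s UNIV = t"
  proof -
    have "(\<Sum>k\<in>UNIV. part e $ k) = s e" for e
      by (simp add: sum_UNIV_Plus part_def edge_part_nth sum.distrib s_def)
    then have "sum s UNIV = (\<Sum>e\<in>UNIV. \<Sum>k\<in>UNIV. part e $ k)"
      by simp
    also have "\<dots> = (\<Sum>k\<in>UNIV. \<Sum>e\<in>UNIV. part e $ k)"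
      by (rule sum.swap)
    also have "\<dots> = (\<Sum>k\<in>UNIV. x $ k)"
      using \<open>x = sum part UNIV\<close> by simp
    finally show ?thesis
      using R by simp
  qed
  moreover have "sum part UNIV \<in> (*\<^sub>R) (sum s UNIV) ` cosmological_polytope ends"
  proof (rule scaled_convex_sum)
    show "0 \<le> s e" for e
      using c[of e] by (simp add: s_def)
    show "convex (cosmological_polytope ends)"
      by (simp add: cosmological_polytope_def)
    show "cosmological_polytope ends \<noteq> {}"
      using part by blast
  qed (use part in auto)
  ultimately show "x \<in> (*\<^sub>R) t ` cosmological_polytope ends"
    by simp
qed

section \<open>From single edges to multi-edges\<close>

text \<open>Whether an edge meets \<open>v\<close> depends only on its endpoint set, so the edges at
  \<open>v\<close> fall into whole parallel classes.\<close>

lemma sum_edges_at: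
  fixes ends :: "'e::finite \<Rightarrow> 'v set"
  shows "(\<Sum>k | k \<in> range ends \<and> v \<in> k. \<Sum>e | ends e = k. f e) = (\<Sum>e | v \<in> ends e. f e)"
proof -
  have "(\<Sum>k | k \<in> range ends \<and> v \<in> k. \<Sum>e | ends e = k. f e) =
      (\<Sum>k | k \<in> range ends \<and> v \<in> k. \<Sum>e | e \<in> {e. v \<in> ends e} \<and> ends e = k. f e)"
    by (intro sum.cong refl) auto
  also have "\<dots> = (\<Sum>e | v \<in> ends e. f e)"
    by (rule sum.group) auto
  finally show ?thesis .
qed

text \<open>
  An edge with a negative coordinate forces that amount at both of its endpoints, and parallel
  edges with nonnegative coordinates act like a single one carrying their sum.
\<close>

lemma edge_decomposable_iff_splittable:
  fixes ends :: "'e::finite \<Rightarrow> 'v::finite set"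
  shows "edge_decomposable ends y x \<longleftrightarrow>
    splittable UNIV (range ends) (\<lambda>k. \<Sum>e | ends e = k. max 0 (y e))
      (\<lambda>v. x v - (\<Sum>e | v \<in> ends e. max 0 (- y e)))"
    (is "_ \<longleftrightarrow> splittable UNIV ?K ?P ?z")
proof
  assume "edge_decomposable ends y x"
  then obtain u where u: "\<And>e v. v \<in> ends e \<Longrightarrow> - y e \<le> u e v" "\<And>e. 0 \<le> sum (u e) (ends e)"
      "\<And>v. (\<Sum>e | v \<in> ends e. u e v) \<le> x v"
    unfolding edge_decomposable_def by blast
  \<comment> \<open>Parallel edges are pooled once the amounts forced by negative coordinates are
    subtracted.\<close>
  define w where "w k v = (\<Sum>e | ends e = k. u e v - max 0 (- y e))" for k v
  have w1: "- ?P k \<le> w k v" if "v \<in> k" for k v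
    unfolding w_def sum_negf[symmetric] using u(1) that by (intro sum_mono) fastforce
  have w2: "0 \<le> sum (w k) k" for k
  proof -
    have eq: "sum (w k) k = (\<Sum>e | ends e = k. \<Sum>v\<in>k. u e v - max 0 (- y e))"
      unfolding w_def by (rule sum.swap)
    \<comment> \<open>For \<open>y e \<ge> 0\<close> nothing is subtracted; otherwise each endpoint
      carries at least \<open>- y e\<close>, so every term is nonnegative.\<close>
    have le: "0 \<le> (\<Sum>v\<in>k. u e v - max 0 (- y e))" if e: "ends e = k" for e
    proof (cases "0 \<le> y e")
      case True
      then show ?thesis
        using u(2)[of e] e by simp
    next
      case False
      then show ?thesis
        using u(1)[of _ e] e by (intro sum_nonneg) fastforce
    qed
    show ?thesis
      unfolding eq by (rule sum_nonneg) (use le in simp)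
  qed
  have w3: "(\<Sum>k | k \<in> ?K \<and> v \<in> k. w k v) \<le> ?z v" for v
    unfolding w_def sum_edges_at using u(3)[of v] by (simp add: sum_subtractf)
  show "splittable UNIV ?K ?P ?z"
    unfolding splittable_def by (intro exI[of _ w] conjI ballI w1 w2 w3)
next
  assume "splittable UNIV ?K ?P ?z"
  then obtain w where W: "\<forall>k\<in>?K. (\<forall>v\<in>k. - ?P k \<le> w k v) \<and> 0 \<le> sum (w k) k"
      "\<forall>v\<in>UNIV. (\<Sum>k | k \<in> ?K \<and> v \<in> k. w k v) \<le> ?z v"
    unfolding splittable_def by (elim exE conjE)
  have w: "- ?P (ends e) \<le> w (ends e) v" if "v \<in> ends e" for e v
    using bspec[OF W(1) rangeI] that by blast
  have w2: "0 \<le> sum (w (ends e)) (ends e)" for e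
    using bspec[OF W(1) rangeI] by blast
  have w3: "(\<Sum>k | k \<in> ?K \<and> v \<in> k. w k v) \<le> ?z v" for v
    using bspec[OF W(2) UNIV_I] .
  \<comment> \<open>\<open>l e\<close> is the fraction of the pooled value of the class
    \<open>k\<close> handed to \<open>e\<close>, proportional to the positive part of
    \<open>y e\<close>.\<close>
  define Q where "Q k l \<longleftrightarrow> (\<forall>e. ends e = k \<longrightarrow> 0 \<le> l e \<and> l e * ?P k = max 0 (y e)) \<and>
    (\<Sum>e | ends e = k. l e) = 1" for k l
  have "\<exists>l. Q k l" if k: "k \<in> ?K" for k
  proof (cases "?P k = 0")
    case True
    have pos: "max 0 (y e) = 0" if "ends e = k" for e
      by (rule sum_nonneg_0[OF _ _ True]) (use that in simp_all)
    \<comment> \<open>All positive parts are 0 here, so one edge of the class may take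
      everything.\<close>
    obtain f where f: "ends f = k"
      using k by blast
    show ?thesis
      unfolding Q_def
    proof (intro exI[of _ "\<lambda>e. if e = f then 1 else 0"] conjI allI impI)
      show "(if e = f then 1 else 0) * ?P k = max 0 (y e)" if "ends e = k" for e
        by (simp only: True pos[OF that] mult_zero_right)
      show "(\<Sum>e | ends e = k. if e = f then 1 else 0 :: real) = 1"
        using f by simp
    qed simp
  next
    case False
    moreover have "0 \<le> ?P k"
      by (rule sum_nonneg) simp
    ultimately have pos: "0 < ?P k"
      by linarith
    show ?thesis
      unfolding Q_def
    proof (intro exI[of _ "\<lambda>e. max 0 (y e) / ?P k"] conjI allI impI)
      show "0 \<le> max 0 (y e) / ?P k" for e
        using pos by (intro divide_nonneg_pos) simp_all
      show "max 0 (y e) / ?P k * ?P k = max 0 (y e)" for e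
        by (rule nonzero_eq_divide_eq[THEN iffD1, OF False refl])
      show "(\<Sum>e | ends e = k. max 0 (y e) / ?P k) = 1"
        unfolding sum_divide_distrib[symmetric] by (rule divide_self[OF False])
    qed
  qed
  then obtain L where L: "\<forall>k\<in>?K. Q k (L k)"
    using bchoice[of ?K Q] by blast
  have l: "0 \<le> L (ends e) e" "L (ends e) e * ?P (ends e) = max 0 (y e)" for e
    using bspec[OF L rangeI, of e] unfolding Q_def by simp_all
  have l1: "(\<Sum>e | ends e = k. L k e) = 1" if "k \<in> ?K" for k
    using bspec[OF L that] unfolding Q_def by (rule conjunct2)
  \<comment> \<open>The forced amount plus the fraction of the pooled value due to
    \<open>e\<close>.\<close>
  define u where "u e v = max 0 (- y e) + L (ends e) e * w (ends e) v" for e v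
  show "edge_decomposable ends y x"
    unfolding edge_decomposable_def
  proof (intro exI[of _ u] conjI allI ballI)
    fix e v
    assume "v \<in> ends e"
    then have "L (ends e) e * - ?P (ends e) \<le> L (ends e) e * w (ends e) v"
      using w l(1) by (intro mult_left_mono)
    then have "- max 0 (y e) \<le> L (ends e) e * w (ends e) v"
      using l(2)[of e] by simp
    then show "- y e \<le> u e v"
      by (auto simp: u_def max_def split: if_splits)
  next
    fix e
    have "sum (u e) (ends e) = (\<Sum>v\<in>ends e. max 0 (- y e)) + L (ends e) e * sum (w (ends e)) (ends e)"
      unfolding sum_distrib_left sum.distrib[symmetric] by (rule sum.cong) (simp_all add: u_def)
    moreover have "0 \<le> (\<Sum>v\<in>ends e. max 0 (- y e))"
      by (intro sum_nonneg) auto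
    ultimately show "0 \<le> sum (u e) (ends e)"
      using l(1)[of e] w2[of e] by simp
  next
    fix v
    have "(\<Sum>e | v \<in> ends e. L (ends e) e * w (ends e) v) =
        (\<Sum>k | k \<in> ?K \<and> v \<in> k. \<Sum>e | ends e = k. L (ends e) e * w (ends e) v)"
      by (rule sum_edges_at[symmetric])
    also have "\<dots> = (\<Sum>k | k \<in> ?K \<and> v \<in> k. (\<Sum>e | ends e = k. L k e) * w k v)"
      by (intro sum.cong refl) (simp add: sum_distrib_right)
    also have "\<dots> = (\<Sum>k | k \<in> ?K \<and> v \<in> k. w k v)"
      by (intro sum.cong refl) (simp add: l1)
    finally show "(\<Sum>e | v \<in> ends e. u e v) \<le> x v"
      using w3[of v] by (simp add: u_def sum.distrib)
  qed
qed

section \<open>Lattice points and the Ehrhart series\<close>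

text \<open>Undoes the normalisation: each vertex regains the negative parts of its incident
  edges.\<close>

definition lattice_vec :: "('e::finite \<Rightarrow> 'v set) \<Rightarrow> ('v \<Rightarrow> int) \<times> ('e \<Rightarrow> int) \<Rightarrow> real ^ ('v::finite + 'e)" where
  "lattice_vec ends p = (\<chi> k. case k of
     Inl v \<Rightarrow> of_int (fst p v + (\<Sum>e | v \<in> ends e. max 0 (- snd p e))) | Inr e \<Rightarrow> of_int (snd p e))"

text \<open>For fixed edge coordinates the normalisation is an integer translation, hence a
  bijection of lattice points, and the coordinate sum that singles out the dilate becomes the
  height.\<close>

lemma bij_betw_lattice_points:
  fixes ends :: "'e::finite \<Rightarrow> 'v::finite set"
  assumes loopless: "loopless ends" and inc: "\<And>v. \<exists>e. v \<in> ends e"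
  shows "bij_betw (lattice_vec ends) {p \<in> points ends UNIV (range ends). height p UNIV = int t}
    (lattice_points ((\<lambda>x. real t *\<^sub>R x) ` cosmological_polytope ends))"
proof -
  let ?N = "\<lambda>y v. \<Sum>e | v \<in> ends e. max 0 (- y e) :: int"
  have iff: "lattice_vec ends (z, y) \<in> (\<lambda>x. real t *\<^sub>R x) ` cosmological_polytope ends \<longleftrightarrow>
      (z, y) \<in> points ends UNIV (range ends) \<and> height (z, y) UNIV = int t" for z y
  proof -
    \<comment> \<open>Every edge has two endpoints, whence the factor 2 below.\<close>
    have "(\<Sum>v\<in>UNIV. ?N y v) = (\<Sum>e\<in>UNIV. \<Sum>v | v \<in> ends e. max 0 (- y e))"
      using sum.swap_restrict[of UNIV UNIV "\<lambda>v e. max 0 (- y e)" "\<lambda>v e. v \<in> ends e"] by simp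
    also have "\<dots> = (\<Sum>e\<in>UNIV. 2 * max 0 (- y e))"
      using loopless by (intro sum.cong) (auto simp: loopless_def)
    also have "\<dots> + (\<Sum>e\<in>UNIV. y e) = (\<Sum>e\<in>UNIV. \<bar>y e\<bar>)"
      unfolding sum.distrib[symmetric] by (intro sum.cong) auto
    finally have "height (z, y) UNIV = (\<Sum>v\<in>UNIV. z v + ?N y v) + (\<Sum>e\<in>UNIV. y e)"
      by (simp add: height_def sum.distrib)
    moreover have "(\<Sum>k\<in>UNIV. lattice_vec ends (z, y) $ k) =
        of_int ((\<Sum>v\<in>UNIV. z v + ?N y v) + (\<Sum>e\<in>UNIV. y e))"
      by (simp add: sum_UNIV_Plus lattice_vec_def)
    ultimately have h: "(\<Sum>k\<in>UNIV. lattice_vec ends (z, y) $ k) = real t \<longleftrightarrow> height (z, y) UNIV = int t"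
      by (metis of_int_eq_iff of_int_of_nat_eq)
    have "edge_decomposable ends (\<lambda>e. lattice_vec ends (z, y) $ Inr e) (\<lambda>v. lattice_vec ends (z, y) $ Inl v) \<longleftrightarrow>
        splittable UNIV (range ends) (\<lambda>k. of_int (pos_sum ends y k)) (\<lambda>v. of_int (z v))"
      unfolding edge_decomposable_iff_splittable
      by (rule splittable_cong) (simp_all add: lattice_vec_def pos_sum_def edges_in_def of_int_max)
    then show ?thesis
      using h scaled_polytope_iff[OF loopless inc, of "real t" "lattice_vec ends (z, y)"]
      by (auto simp: points_def supported_def edges_in_def)
  qed
  have int: "lattice_vec ends p $ k \<in> \<int>" for p k
    by (cases k) (auto simp: lattice_vec_def)
  have inj: "inj (lattice_vec ends)"
  proof (rule injI)
    fix p q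
    assume pq: "lattice_vec ends p = lattice_vec ends q"
    \<comment> \<open>Edge coordinates are compared first: they determine the shift
      \<open>?N\<close>, which then cancels.\<close>
    then have y: "snd p = snd q"
      by (auto simp: lattice_vec_def vec_eq_iff fun_eq_iff split: sum.splits)
    have "fst p v + ?N (snd p) v = fst q v + ?N (snd q) v" for v
      using arg_cong[OF pq, of "\<lambda>x. x $ Inl v"] unfolding lattice_vec_def
      by (simp only: vec_lambda_beta sum.case of_int_eq_iff)
    then have "fst p = fst q"
      by (simp add: y fun_eq_iff)
    with y show "p = q"
      by (rule prod_eqI[rotated])
  qed
  have surj: "x \<in> range (lattice_vec ends)" if "\<forall>k. x $ k \<in> \<int>" for x
  proof -
    let ?y = "\<lambda>e. \<lfloor>x $ Inr e\<rfloor>" and ?z = "\<lambda>v. \<lfloor>x $ Inl v\<rfloor>"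
    have "lattice_vec ends (\<lambda>v. ?z v - ?N ?y v, ?y) $ k = x $ k" for k
      using that by (cases k) (simp_all add: lattice_vec_def)
    then have "x = lattice_vec ends (\<lambda>v. ?z v - ?N ?y v, ?y)"
      by (simp add: vec_eq_iff)
    then show ?thesis
      by blast
  qed
  show ?thesis
    unfolding bij_betw_def
  proof
    show "inj_on (lattice_vec ends) {p \<in> points ends UNIV (range ends). height p UNIV = int t}"
      using inj by (rule inj_on_subset) simp
    show "lattice_vec ends ` {p \<in> points ends UNIV (range ends). height p UNIV = int t} =
        lattice_points ((\<lambda>x. real t *\<^sub>R x) ` cosmological_polytope ends)"
    proof (intro equalityI subsetI)
      fix x
      assume "x \<in> lattice_vec ends ` {p \<in> points ends UNIV (range ends). height p UNIV = int t}"
      then show "x \<in> lattice_points ((\<lambda>x. real t *\<^sub>R x) ` cosmological_polytope ends)"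
        using int iff unfolding lattice_points_def by auto
    next
      fix x
      assume x: "x \<in> lattice_points ((\<lambda>x. real t *\<^sub>R x) ` cosmological_polytope ends)"
      then obtain z y where zy: "x = lattice_vec ends (z, y)"
        using surj unfolding lattice_points_def by fastforce
      then show "x \<in> lattice_vec ends ` {p \<in> points ends UNIV (range ends). height p UNIV = int t}"
        using x iff unfolding lattice_points_def by blast
    qed
  qed
qed

lemma ehrhart_series_eq:
  fixes ends :: "'e::finite \<Rightarrow> 'v::finite set"
  assumes "loopless ends" "\<And>v. \<exists>e. v \<in> ends e"
    and F: "has_gf (points ends UNIV (range ends)) (\<lambda>p. height p UNIV) (\<lambda>_. 1) F"
  shows "ehrhart_series (cosmological_polytope ends) = F"
proof (rule fps_ext)
  fix t
  let ?L = "\<lambda>t. lattice_points ((\<lambda>x. real t *\<^sub>R x) ` cosmological_polytope ends)"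
  have card: "int (card (?L t)) = fps_nth F t" for t
  proof -
    have "int (card {p \<in> points ends UNIV (range ends). height p UNIV = int t}) = fps_nth F t"
      using F by (simp add: has_gf_def)
    then show ?thesis
      by (simp only: bij_betw_same_card[OF bij_betw_lattice_points[OF assms(1,2)]])
  qed
  show "fps_nth (ehrhart_series (cosmological_polytope ends)) t = fps_nth F t"
  proof (cases "t = 0")
    case True
    \<comment> \<open>The constant coefficient of the Ehrhart series is 1 by definition; that of
      \<open>F\<close> counts the dilate by 0, a single point since the polytope is
      nonempty.\<close>
    obtain i j where "ends undefined = {i, j}"
      using assms(1) by (metis loopless_def card_2_iff)
    then have "cosmological_polytope ends \<noteq> {}"
      using edge_part_in_polytope by blast
    then have "?L 0 = {0}"
      by (auto simp: lattice_points_def image_iff)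
    then show ?thesis
      using card[of 0] True by (simp add: ehrhart_series_def)
  qed (simp add: ehrhart_series_def card)
qed

section \<open>Dimension of the polytope\<close>

text \<open>Midpoints of generators give all standard unit vectors, so the linear span is the whole
  space; the hyperplane of coordinate sum 1 contains the polytope and misses the origin, which costs
  one dimension.\<close>

lemma aff_dim_cosmological_polytope:
  fixes ends :: "'e::finite \<Rightarrow> 'v::finite set"
  assumes "loopless ends" and inc: "\<And>v. \<exists>e. v \<in> ends e"
  shows "aff_dim (cosmological_polytope ends) = int (CARD('v) + CARD('e)) - 1"
proof -
  let ?C = "cosmological_polytope ends"
  have conv: "convex ?C"
    by (simp add: cosmological_polytope_def)
  have mid: "(1/2) *\<^sub>R x + (1/2) *\<^sub>R y \<in> ?C" if "x \<in> ?C" "y \<in> ?C" for x y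
    using convexD[OF conv that, of "1/2" "1/2"] by simp
  have v: "axis (Inl i) 1 \<in> ?C" for i
  proof -
    obtain f where "i \<in> ends f"
      using inc by blast
    then obtain j where f: "ends f = {i, j}"
      using assms(1) by (metis card_2_iff insertE insert_commute loopless_def singletonD)
    have "axis (Inl i) 1 = (1/2) *\<^sub>R edge_part f i j 1 1 (-1) + (1/2) *\<^sub>R edge_part f i j 1 (-1) 1"
      by (simp add: edge_part_def vertex_vec_def algebra_simps flip: scaleR_add_left)
    then show ?thesis
      using mid edge_part_in_polytope[of ends f i j, OF f] by metis
  qed
  have e: "axis (Inr f) 1 \<in> ?C" for f
  proof -
    obtain i j where f: "ends f = {i, j}"
      using assms(1) by (metis loopless_def card_2_iff)
    have "axis (Inr f) 1 = (1/2) *\<^sub>R edge_part f i j 1 (-1) 1 + (1/2) *\<^sub>R edge_part f i j (-1) 1 1"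
      by (simp add: edge_part_def edge_vec_def algebra_simps flip: scaleR_add_left)
    then show ?thesis
      using mid edge_part_in_polytope[of ends f i j, OF f] by metis
  qed
  have "Basis \<subseteq> ?C"
  proof
    fix b :: "real ^ ('v + 'e)"
    assume "b \<in> Basis"
    then obtain k where "b = axis k 1"
      by (auto simp: Basis_vec_def)
    then show "b \<in> ?C"
      using v e by (cases k) auto
  qed
  \<comment> \<open>Adjoining 0 makes affine and linear dimension agree and raises the affine
    dimension by exactly 1.\<close>
  then have "span (insert 0 ?C) = UNIV"
    by (metis span_Basis span_mono subset_insertI2 top.extremum_uniqueI)
  then have "dim (insert 0 ?C) = CARD('v) + CARD('e)"
    by (metis dim_span dim_UNIV DIM_cart DIM_real mult.right_neutral card_sum)
  moreover have "aff_dim (insert 0 ?C) = int (dim (insert 0 ?C))"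
    by (rule aff_dim_zero) (simp add: hull_inc)
  moreover have "0 \<notin> affine hull ?C"
  proof
    assume 0: "0 \<in> affine hull ?C"
    have "affine hull ?C \<subseteq> {x. (\<Sum>k\<in>UNIV. x $ k) = 1}"
    proof (rule hull_minimal)
      show "?C \<subseteq> {x. (\<Sum>k\<in>UNIV. x $ k) = 1}"
        using polytope_subset_edge_decomposable[OF assms(1)] by blast
      show "affine {x :: real ^ ('v + 'e). (\<Sum>k\<in>UNIV. x $ k) = 1}"
        by (auto simp: affine_def sum.distrib sum_distrib_left[symmetric])
    qed
    then show False
      using 0 by auto
  qed
  ultimately show ?thesis
    by (simp add: aff_dim_insert)
qed

section \<open>The product formula for multitrees\<close>

theorem theorem4p9:
  fixes n :: nat and a :: "nat \<Rightarrow> nat" and ends :: "'e::finite \<Rightarrow> 'v::finite set"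
  assumes "n \<ge> 1"
    and "\<And>i. i \<in> {1..n} \<Longrightarrow> a i \<ge> 1"
    and "multitree n a ends"
  shows "h_star (cosmological_polytope ends) =
    fps_of_poly (\<Prod>i=1..n. [:1, 1:] ^ a i + smult (2 * int (a i)) ([:0, 1:] * [:1, 1:] ^ (a i - 1)))"
proof -
  have loopless: "loopless ends" and conn: "connected_graph ends" and V: "CARD('v) = n + 1"
    using assms(3) by (auto simp: multitree_def)
  obtain M where M: "bij_betw M {1..n} (multi_edges ends)" "\<And>i. i \<in> {1..n} \<Longrightarrow> card (M i) = a i"
    using assms(3) by (auto simp: multitree_def)
  let ?c = "\<lambda>k. edges_in ends {k}"
  \<comment> \<open>Multi-edges are the nonempty fibres of \<open>ends\<close>; looplessness
    supplies the two distinct endpoints.\<close>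
  have me: "multi_edges ends = ?c ` range ends"
  proof (intro equalityI subsetI)
    fix X
    assume "X \<in> multi_edges ends"
    then obtain u v where "X = ?c {u, v}" "X \<noteq> {}"
      by (auto simp: multi_edges_def edges_between_def edges_in_def)
    then show "X \<in> ?c ` range ends"
      by (auto simp: edges_in_def)
  next
    fix X
    assume "X \<in> ?c ` range ends"
    then obtain e where X: "X = ?c (ends e)"
      by auto
    moreover obtain u v where "ends e = {u, v}" "u \<noteq> v"
      using loopless by (metis loopless_def card_2_iff)
    ultimately show "X \<in> multi_edges ends"
      by (auto simp: multi_edges_def edges_between_def edges_in_def)
  qed
  have inj: "inj_on ?c (range ends)"
    by (auto simp: inj_on_def edges_in_def)
  \<comment> \<open>There are \<open>n\<close> parallel classes, and a spanning tree on
    \<open>n + 1\<close> vertices uses \<open>n\<close> of them, hence all.\<close>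
  have "card (range ends) = n"
    using card_image[OF inj] bij_betw_same_card[OF M(1)] me by simp
  moreover obtain K where K: "K \<subseteq> range ends" "grown_tree UNIV K"
    using connected_grown_tree[OF conn] by blast
  moreover have "card K = n"
    using grown_tree_facts(4)[OF K(2)] V by simp
  ultimately have "K = range ends"
    by (intro card_subset_eq) auto
  then obtain F where F: "has_gf (points ends UNIV (range ends)) (\<lambda>p. height p UNIV) (\<lambda>_. 1) F"
    "F * (1 - fps_X) ^ (CARD('v) + CARD('e)) = (\<Prod>k\<in>range ends. edge_factor (card (?c k)))"
    using has_gf_points[OF K(2,1)] by (auto simp: edges_in_def)
  \<comment> \<open>As \<open>n \<ge> 1\<close>, every vertex is connected to a different one and so
    has an incident edge.\<close>
  have inc: "\<exists>e. v \<in> ends e" for v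
  proof -
    have "CARD('v) \<noteq> 1"
      using V assms(1) by simp
    then obtain u where "u \<noteq> v"
      by (metis (full_types) UNIV_I card_1_singleton_iff One_nat_def UNIV_eq_I insertI1 singletonI)
    moreover have "(adjacent ends)\<^sup>*\<^sup>* v u"
      using conn by (auto simp: connected_graph_def)
    ultimately obtain w where "adjacent ends v w"
      by (metis converse_rtranclpE)
    then show ?thesis
      by (auto simp: adjacent_def)
  qed
  have poly: "edge_factor b =
      fps_of_poly ([:1, 1:] ^ b + smult (2 * int b) ([:0, 1:] * [:1, 1:] ^ (b - 1)))" for b
  proof -
    have "fps_of_poly [:1, 1:] = (1 + fps_X :: int fps)" "fps_of_poly [:0, 1:] = (fps_X :: int fps)"
      by (rule fps_ext, auto simp: coeff_pCons split: nat.splits)+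
    moreover have "fps_const (2 * int b) = of_nat (2 * b)"
      by (simp add: fps_of_nat[symmetric])
    ultimately show ?thesis
      by (simp only: edge_factor_def fps_of_poly_add fps_of_poly_smult fps_of_poly_mult fps_of_poly_power mult.assoc)
  qed
  \<comment> \<open>The exponent in \<open>h_star\<close> is exactly the one that clears the
    denominator of \<open>F\<close>.\<close>
  have "nat (aff_dim (cosmological_polytope ends) + 1) = CARD('v) + CARD('e)"
    unfolding aff_dim_cosmological_polytope[OF loopless inc] by linarith
  then have "h_star (cosmological_polytope ends) = F * (1 - fps_X) ^ (CARD('v) + CARD('e))"
    by (simp only: h_star_def ehrhart_series_eq[OF loopless inc F(1)])
  also have "\<dots> = (\<Prod>X\<in>multi_edges ends. edge_factor (card X))"
    unfolding F(2) me by (simp add: prod.reindex[OF inj])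
  also have "\<dots> = (\<Prod>i=1..n. edge_factor (a i))"
    using prod.reindex_bij_betw[OF M(1), of "\<lambda>X. edge_factor (card X)"] M(2) by simp
  also have "\<dots> = fps_of_poly (\<Prod>i=1..n. [:1, 1:] ^ a i + smult (2 * int (a i)) ([:0, 1:] * [:1, 1:] ^ (a i - 1)))"
    by (simp only: poly fps_of_poly_prod)
  finally show ?thesis .
qed

end
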